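(* There is a positive constant $c$ and, for all fixed integers $a\ge b\ge 2$, a positive constant $c'=c'_a$ such that for all integers $n\ge 2$, \[ 2^{c\log^2 n}\;\le\; \mathrm{gr}(\Gamma_{a\times b},K_n)\;\le\; 2^{c' n^{1-(2^b-1)^{-1}}\log n}. \]
   Context: The $m\times n$ grid graph $\Gamma_{m\times n}$ is the Cartesian product $K_m\square K_n$: its vertex set is $[m]\times[n]$ and two distinct vertices are adjacent iff they share exactly one coordinate. An $a\times b$ subgrid of $\Gamma_{m\times n}$ is an induced copy of $\Gamma_{a\times b}$, i.e. the induced subgraph on $X\times Y$ with $|X|=a$, $|Y|=b$ (or with the roles of the two coordinates swapped). $\mathrm{gr}(\Gamma_{a\times b},K_n)$ is the smallest $N$ such that every red/blue coloring of the edges of $\Gamma_{N\times N}$ contains an $a\times b$ subgrid all of whose edges are red, or a clique on $n$ vertices all of whose edges are blue. Logarithms are base $2$. *)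

theory Defs
  imports Complex_Main "HOL-Library.Ramsey" "HOL-Library.Extended_Real"
begin

definition grid_vertices :: "nat \<Rightarrow> nat \<Rightarrow> (nat \<times> nat) set" where
  "grid_vertices m n = {1..m} \<times> {1..n}"

text \<open>Sharing exactly one coordinate already forces the two endpoints to be distinct.\<close>

definition grid_edges :: "nat \<Rightarrow> nat \<Rightarrow> (nat \<times> nat) set set" where
  "grid_edges m n =
     {{u, v} | u v. u \<in> grid_vertices m n \<and> v \<in> grid_vertices m n \<and>
                    (fst u = fst v) \<noteq> (snd u = snd v)}"

datatype colour = Red | Blue

text \<open>A colouring is a total function on sets of vertices; only its values on the edges of the
  grid graph matter below.\<close>

definition has_red_subgrid ::
    "nat \<Rightarrow> ((nat \<times> nat) set \<Rightarrow> colour) \<Rightarrow> nat \<Rightarrow> nat \<Rightarrow> bool" where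
  "has_red_subgrid N col a b \<longleftrightarrow>
     (\<exists>X Y. X \<subseteq> {1..N} \<and> Y \<subseteq> {1..N} \<and>
            (card X = a \<and> card Y = b \<or> card X = b \<and> card Y = a) \<and>
            (\<forall>e \<in> grid_edges N N. e \<subseteq> X \<times> Y \<longrightarrow> col e = Red))"

definition has_blue_clique ::
    "nat \<Rightarrow> ((nat \<times> nat) set \<Rightarrow> colour) \<Rightarrow> nat \<Rightarrow> bool" where
  "has_blue_clique N col n \<longleftrightarrow>
     (\<exists>S \<subseteq> grid_vertices N N. card S = n \<and> clique S {e \<in> grid_edges N N. col e = Blue})"

text \<open>The infimum is taken in \<^typ>\<open>enat\<close>, so that it is \<open>\<infinity>\<close> if no such \<open>N\<close> exists,
  and otherwise the smallest one. A finite upper bound thus includes the existence of \<open>N\<close>.\<close>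

definition gr :: "nat \<Rightarrow> nat \<Rightarrow> nat \<Rightarrow> enat" where
  "gr a b n =
     (INF N \<in> {N. \<forall>col. has_red_subgrid N col a b \<or> has_blue_clique N col n}. enat N)"

end

theory Submission
  imports Defs "HOL-Library.FuncSet"
begin

text \<open>
  Lower bound. Index both rows and columns by the words \<open>c i\<close> of a code of length \<open>q\<close> over \<open>Q\<close>
  letters in which two words agree in fewer than \<open>k\<close> places, and take a relation \<open>M\<close> on the places
  such that any \<open>k\<close> columns of \<open>M\<close> have a common row of ones and any \<open>k\<close> rows have a common column
  of zeros. To a pair \<open>W\<close> of columns belong a place \<open>u W\<close> with \<open>M (u W) z\<close> for all places \<open>z\<close> where
  the two words agree, and a random letter \<open>f W\<close>; the pair is red in row \<open>i\<close> iff \<open>c i (u W) = f W\<close>.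
  Pairs \<open>V\<close> of rows are treated in the same way with a place \<open>v V\<close> where all \<open>M x (v V)\<close> fail. In a
  red square on \<open>V\<close> and \<open>W\<close>, the words of \<open>V\<close> agree at \<open>u W\<close> and those of \<open>W\<close> agree at \<open>v V\<close>, so
  \<open>M (u W) (v V)\<close> both holds and fails. Randomness of the letters excludes blue cliques. With
  \<open>q = 8 ^ k\<close> and \<open>Q = 64 ^ k\<close> the code has \<open>8 ^ (k * k)\<close> words, and \<open>n = 1024 ^ k\<close> suffices.

  Upper bound. By pigeonhole, about \<open>n powr (e / 2)\<close> columns form a red clique in all rows of a large
  set; this costs a factor \<open>n ^ (l * l)\<close>. Among their column graphs, some \<open>a\<close> have a common
  \<open>b\<close>-clique or one of them is sparse on a large subset. A sparse graph without independent sets of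
  size \<open>n\<close> has, on a further large subset, only very small independent sets, as in the theorem of
  Erdos and Szemeredi. Doing this for \<open>a\<close> columns contradicts Ramsey's theorem. The argument gives the
  exponent \<open>1 - 1 / (2 * b - 1)\<close>, and \<open>2 * b - 1 \<le> 2 ^ b - 1\<close>.
\<close>

subsection \<open>The lower bound\<close>

lemma exists_avoiding_all:
  assumes "finite A" "finite F" "(\<Sum>a\<in>A. card (B a \<inter> F)) < card F"
  shows "\<exists>f\<in>F. \<forall>a\<in>A. f \<notin> B a"
proof (rule ccontr)
  assume "\<not> ?thesis"
  then have "F \<subseteq> (\<Union>a\<in>A. B a \<inter> F)" by auto
  then have "card F \<le> card (\<Union>a\<in>A. B a \<inter> F)"
    using assms by (intro card_mono) auto
  also have "\<dots> \<le> (\<Sum>a\<in>A. card (B a \<inter> F))"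
    using assms by (intro card_UN_le) auto
  finally show False using assms by simp
qed

text \<open>For a uniformly random \<open>f\<close> from \<open>E\<close> to \<open>Q\<close>
  letters the values on \<open>P a\<close> are independent, and each misses its target
  \<open>h a e\<close> with probability \<open>1 - 1 / Q\<close>. So \<open>a\<close> fails with
  probability at most \<open>(1 - 1 / Q) ^ p\<close>, and a union bound over \<open>A\<close>
  finishes.\<close>

lemma exists_hitting_function:
  fixes Q p :: nat and h :: "'i \<Rightarrow> 'e \<Rightarrow> nat"
  assumes "finite E" "finite A" "0 < Q"
    and P: "\<And>a. a \<in> A \<Longrightarrow> P a \<subseteq> E \<and> p \<le> card (P a)"
    and h: "\<And>a e. a \<in> A \<Longrightarrow> e \<in> E \<Longrightarrow> h a e < Q"
    and few: "real (card A) * (1 - 1 / real Q) ^ p < 1"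
  shows "\<exists>f. \<forall>a\<in>A. \<exists>e\<in>P a. f e = h a e"
proof -
  let ?F = "PiE E (\<lambda>_. {..<Q})"
  let ?B = "\<lambda>a. {f. \<forall>e\<in>P a. f e \<noteq> h a e}"
  have cF: "card ?F = Q ^ card E" using assms by (simp add: card_PiE)
  have cB: "real (card (?B a \<inter> ?F)) \<le> real (Q ^ card E) * (1 - 1 / real Q) ^ p" if "a \<in> A" for a
  proof -
    have fin: "finite (P a)" using P[OF that] \<open>finite E\<close> finite_subset by blast
    have "?B a \<inter> ?F = PiE E (\<lambda>e. if e \<in> P a then {..<Q} - {h a e} else {..<Q})"
      using P[OF that] by (auto simp: PiE_iff split: if_splits)
    then have "card (?B a \<inter> ?F) = (\<Prod>e\<in>E. if e \<in> P a then Q - 1 else Q)"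
      using \<open>finite E\<close> h[OF that] by (auto simp: card_PiE intro!: prod.cong)
    also have "\<dots> = (Q - 1) ^ card (P a) * Q ^ card (E - P a)"
      using \<open>finite E\<close> P[OF that] by (simp add: prod.If_cases Int_absorb1 Diff_eq)
    finally have "real (card (?B a \<inter> ?F)) = (real Q - 1) ^ card (P a) * real Q ^ card (E - P a)"
      using \<open>0 < Q\<close> by (simp add: of_nat_diff)
    also have "real Q - 1 = real Q * (1 - 1 / real Q)" using \<open>0 < Q\<close> by (simp add: field_simps)
    also have "(real Q * (1 - 1 / real Q)) ^ card (P a) * real Q ^ card (E - P a)
        = real Q ^ (card (P a) + card (E - P a)) * (1 - 1 / real Q) ^ card (P a)"
      by (simp add: power_add power_mult_distrib mult_ac)
    also have "card (P a) + card (E - P a) = card E"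
      using P[OF that] \<open>finite E\<close> fin by (simp add: card_Diff_subset card_mono)
    also have "real Q ^ card E * (1 - 1 / real Q) ^ card (P a) \<le> real Q ^ card E * (1 - 1 / real Q) ^ p"
      using P[OF that] \<open>0 < Q\<close> by (intro mult_left_mono power_decreasing) auto
    finally show ?thesis by simp
  qed
  have "real (\<Sum>a\<in>A. card (?B a \<inter> ?F)) \<le> (\<Sum>a\<in>A. real (Q ^ card E) * (1 - 1 / real Q) ^ p)"
    unfolding of_nat_sum by (rule sum_mono) (rule cB)
  also have "\<dots> = real (Q ^ card E) * (real (card A) * (1 - 1 / real Q) ^ p)" by simp
  also have "\<dots> < real (Q ^ card E) * 1"
    using few \<open>0 < Q\<close> by (intro mult_strict_left_mono) auto
  finally have "(\<Sum>a\<in>A. card (?B a \<inter> ?F)) < card ?F"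
    by (simp only: cF mult_1_right of_nat_less_iff)
  then obtain f where "\<forall>a\<in>A. f \<notin> ?B a"
    using exists_avoiding_all[of A ?F ?B] \<open>finite A\<close> \<open>finite E\<close> by (auto simp: finite_PiE)
  then show ?thesis by auto
qed

text \<open>A random \<open>M\<close> works. Transposing and complementing \<open>M\<close> exchanges the two kinds of bad events,
  so only the first kind has to be counted.\<close>

lemma exists_dominating_relation:
  fixes q k :: nat
  assumes "k \<le> q" and few: "2 * real q ^ k * (1 - 1 / 2 ^ k) ^ q < 1"
  shows "\<exists>M :: nat \<Rightarrow> nat \<Rightarrow> bool. \<forall>K. K \<subseteq> {..<q} \<and> card K \<le> k \<longrightarrow>
           (\<exists>x<q. \<forall>z\<in>K. M x z) \<and> (\<exists>z<q. \<forall>x\<in>K. \<not> M x z)"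
proof -
  let ?X = "{..<q}"
  let ?F = "PiE ?X (\<lambda>_. Pow ?X)"
  let ?KS = "{K. K \<subseteq> ?X \<and> card K = k}"
  \<comment> \<open>The Boolean tells the two kinds of bad event apart: \<open>True\<close> if no
    row is full on \<open>K\<close>, \<open>False\<close> if no column vanishes on \<open>K\<close>.
    Only sets of exactly \<open>k\<close> places are counted; smaller ones are enlarged at the
    end.\<close>
  let ?A = "?KS \<times> (UNIV :: bool set)"
  let ?B1 = "\<lambda>K. {f. \<forall>x<q. \<not> K \<subseteq> f x}"
  let ?B2 = "\<lambda>K. {f. \<forall>z<q. \<exists>x\<in>K. z \<in> f x}"
  let ?B = "\<lambda>(K, s). if s then ?B1 K else ?B2 K"
  have finK: "finite ?KS" by simp
  have cK: "card ?KS = q choose k" using n_subsets[of ?X k] by simp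
  have cF: "card ?F = (2 ^ q) ^ q" by (simp add: card_PiE card_Pow)
  have finF: "finite ?F" by (auto simp: finite_PiE)
  have c1: "real (card (?B1 K \<inter> ?F)) = real (card ?F) * (1 - 1 / 2 ^ k) ^ q" if K: "K \<in> ?KS" for K
  proof -
    have "?B1 K \<inter> ?F = PiE ?X (\<lambda>_. Pow ?X - {R. K \<subseteq> R})" by (auto simp: PiE_iff)
    then have "card (?B1 K \<inter> ?F) = card (Pow ?X - {R. K \<subseteq> R}) ^ q"
      by (simp add: card_PiE)
    moreover have "card (Pow ?X - {R. K \<subseteq> R}) = 2 ^ q - 2 ^ (q - k)"
    proof -
      have "Pow ?X \<inter> {R. K \<subseteq> R} = (\<lambda>R. R \<union> K) ` Pow (?X - K)"
      proof (intro equalityI subsetI)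
        fix R assume "R \<in> Pow ?X \<inter> {R. K \<subseteq> R}"
        then have "R = (R - K) \<union> K" "R - K \<in> Pow (?X - K)" by auto
        then show "R \<in> (\<lambda>R. R \<union> K) ` Pow (?X - K)" by blast
      qed (use K in auto)
      moreover have "inj_on (\<lambda>R. R \<union> K) (Pow (?X - K))" by (auto simp: inj_on_def)
      ultimately have "card (Pow ?X \<inter> {R. K \<subseteq> R}) = 2 ^ (q - k)"
        using K by (simp add: card_image card_Pow card_Diff_subset[OF finite_subset[of K ?X]])
      then show ?thesis by (simp add: card_Diff_subset_Int card_Pow)
    qed
    ultimately have "real (card (?B1 K \<inter> ?F)) = (2 ^ q - 2 ^ (q - k)) ^ q"
      by (simp add: of_nat_diff power_increasing)
    also have "(2::real) ^ q - 2 ^ (q - k) = 2 ^ q * (1 - 1 / 2 ^ k)"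
      using \<open>k \<le> q\<close> by (simp add: power_diff field_simps)
    finally show ?thesis by (simp add: cF power_mult_distrib)
  qed
  have c2: "card (?B2 K \<inter> ?F) \<le> card (?B1 K \<inter> ?F)" if K: "K \<in> ?KS" for K
  proof -
    let ?t = "\<lambda>f. \<lambda>z\<in>?X. {x\<in>?X. z \<notin> f x}"
    have "inj_on ?t (?B2 K \<inter> ?F)"
    proof (rule inj_onI)
      fix f g assume f: "f \<in> ?B2 K \<inter> ?F" and g: "g \<in> ?B2 K \<inter> ?F" and eq: "?t f = ?t g"
      have "z \<in> f x \<longleftrightarrow> z \<in> g x" if "x < q" "z < q" for x z
        using fun_cong[OF eq, of z] that by auto
      moreover have "f x \<subseteq> ?X" "g x \<subseteq> ?X" if "x < q" for x using f g that by (auto simp: PiE_iff)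
      ultimately have fg: "f x = g x" if "x < q" for x using that by blast
      show "f = g" by (rule PiE_ext[OF IntD2[OF f] IntD2[OF g]]) (simp add: fg)
    qed
    moreover have "?t ` (?B2 K \<inter> ?F) \<subseteq> ?B1 K \<inter> ?F" using K by fastforce
    ultimately show ?thesis using finF by (intro card_inj_on_le) auto
  qed
  have "real (\<Sum>a\<in>?A. card (?B a \<inter> ?F)) \<le> (\<Sum>a\<in>?A. real (card ?F) * (1 - 1 / 2 ^ k) ^ q)"
    unfolding of_nat_sum
  proof (rule sum_mono)
    fix a assume "a \<in> ?A"
    then show "real (card (?B a \<inter> ?F)) \<le> real (card ?F) * (1 - 1 / 2 ^ k) ^ q"
      using c1[of "fst a"] c2[of "fst a"] by (auto simp: split_beta)
  qed
  also have "\<dots> = real (card ?F) * (2 * real (q choose k) * (1 - 1 / 2 ^ k) ^ q)"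
    by (simp add: card_cartesian_product cK)
  also have "\<dots> \<le> real (card ?F) * (2 * real q ^ k * (1 - 1 / 2 ^ k) ^ q)"
  proof -
    have "real (q choose k) \<le> real q ^ k"
      using binomial_le_pow[OF \<open>k \<le> q\<close>] by (simp flip: of_nat_power)
    then show ?thesis by (intro mult_left_mono mult_right_mono) auto
  qed
  also have "\<dots> < real (card ?F) * 1"
    using few by (intro mult_strict_left_mono) (auto simp: cF)
  finally have "(\<Sum>a\<in>?A. card (?B a \<inter> ?F)) < card ?F"
    by (simp only: mult_1_right of_nat_less_iff)
  then have "\<exists>f\<in>?F. \<forall>a\<in>?A. f \<notin> ?B a"
    using finK finF by (intro exists_avoiding_all) auto
  then obtain f where avoid: "\<forall>a\<in>?A. f \<notin> ?B a" by blast
  have f: "f \<notin> ?B1 K \<and> f \<notin> ?B2 K" if "K \<in> ?KS" for K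
    using bspec[OF avoid, of "(K, True)"] bspec[OF avoid, of "(K, False)"] that by simp
  have "(\<exists>x<q. \<forall>z\<in>K. z \<in> f x) \<and> (\<exists>z<q. \<forall>x\<in>K. z \<notin> f x)" if K: "K \<subseteq> ?X" "card K \<le> k" for K
  proof -
    have "\<exists>K'. K \<subseteq> K' \<and> K' \<subseteq> ?X \<and> card K' = k"
      using that \<open>k \<le> q\<close> by (intro exists_subset_between) auto
    then obtain K' where "K \<subseteq> K'" "K' \<in> ?KS" by blast
    then show ?thesis using f[of K'] by fastforce
  qed
  then show ?thesis by (intro exI[of _ "\<lambda>x z. z \<in> f x"]) blast
qed

text \<open>Greedy choice, as for the Gilbert-Varshamov bound: an earlier word together with
  \<open>k\<close> places rules out \<open>Q ^ (q - k)\<close> new words, so fewer than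
  \<open>Q ^ q\<close> words are ruled out in total.\<close>

lemma exists_code:
  fixes q Q k N :: nat
  assumes "k \<le> q" "0 < Q" and "N * q ^ k \<le> Q ^ k"
  shows "\<exists>c :: nat \<Rightarrow> nat \<Rightarrow> nat. (\<forall>i<N. \<forall>x<q. c i x < Q) \<and>
           (\<forall>i<N. \<forall>j<N. i \<noteq> j \<longrightarrow> card {x. x < q \<and> c i x = c j x} < k)"
  using assms(3)
proof (induction N)
  case 0
  then show ?case by simp
next
  case (Suc N)
  have "N * q ^ k \<le> Q ^ k" using Suc.prems by auto
  from Suc.IH[OF this] obtain c :: "nat \<Rightarrow> nat \<Rightarrow> nat" where c: "\<And>i x. i < N \<Longrightarrow> x < q \<Longrightarrow> c i x < Q"
    and agree: "\<And>i j. i < N \<Longrightarrow> j < N \<Longrightarrow> i \<noteq> j \<Longrightarrow> card {x. x < q \<and> c i x = c j x} < k"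
    by blast
  let ?X = "{..<q}"
  let ?F = "PiE ?X (\<lambda>_. {..<Q})"
  let ?KS = "{K. K \<subseteq> ?X \<and> card K = k}"
  let ?B = "\<lambda>(i, K). {f. \<forall>x\<in>K. f x = c i x}"
  have cB: "card (?B (i, K) \<inter> ?F) = Q ^ (q - k)" if "i < N" "K \<in> ?KS" for i K
  proof -
    have "?B (i, K) \<inter> ?F = PiE ?X (\<lambda>x. if x \<in> K then {c i x} else {..<Q})"
      using that c by (auto simp: PiE_iff split: if_splits)
    then have "card (?B (i, K) \<inter> ?F) = (\<Prod>x<q. if x \<in> K then 1 else Q)"
      by (auto simp: card_PiE intro!: prod.cong)
    also have "\<dots> = Q ^ card (?X - K)"
      using that by (simp add: prod.If_cases Int_absorb1 Diff_eq)
    finally show ?thesis using that by (simp add: card_Diff_subset[OF finite_subset[of K ?X]])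
  qed
  have "(\<Sum>a\<in>{..<N} \<times> ?KS. card (?B a \<inter> ?F)) = (\<Sum>a\<in>{..<N} \<times> ?KS. Q ^ (q - k))"
    using cB by (intro sum.cong) auto
  also have "\<dots> = N * (q choose k) * Q ^ (q - k)"
    using n_subsets[of ?X k] by (simp add: card_cartesian_product)
  also have "\<dots> \<le> N * q ^ k * Q ^ (q - k)"
    using binomial_le_pow[OF \<open>k \<le> q\<close>] by (intro mult_right_mono mult_left_mono) auto
  also have "\<dots> < Q ^ k * Q ^ (q - k)"
  proof -
    \<comment> \<open>The assumption for \<open>Suc N\<close> has one spare \<open>q ^ k\<close>,
      which makes the inequality strict. It is positive because \<open>q = 0\<close> forces
      \<open>k = 0\<close>.\<close>
    have "0 < q ^ k" using \<open>k \<le> q\<close> by (cases "k = 0") auto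
    moreover have "N * q ^ k + q ^ k \<le> Q ^ k" using Suc.prems by simp
    ultimately have "N * q ^ k < Q ^ k" by linarith
    then show ?thesis using \<open>0 < Q\<close> by simp
  qed
  also have "\<dots> = card ?F" using \<open>k \<le> q\<close> by (simp add: card_PiE flip: power_add)
  finally obtain f where f: "f \<in> ?F" "\<And>i K. i < N \<Longrightarrow> K \<in> ?KS \<Longrightarrow> f \<notin> ?B (i, K)"
    using exists_avoiding_all[of "{..<N} \<times> ?KS" ?F ?B] by (auto simp: finite_PiE)
  have new: "card {x. x < q \<and> f x = c i x} < k" if "i < N" for i
  proof (rule ccontr)
    assume "\<not> ?thesis"
    then obtain K where "K \<subseteq> {x. x < q \<and> f x = c i x}" "card K = k"
      by (meson not_less obtain_subset_with_card_n)
    then show False using f(2)[OF that, of K] by auto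
  qed
  have new': "card {x. x < q \<and> c i x = f x} < k" if "i < N" for i
    using new[OF that] by (simp add: eq_commute)
  show ?case
    using c agree new new' f(1)
    by (intro exI[of _ "c(N := f)"]) (auto simp: less_Suc_eq PiE_iff)
qed

section \<open>Grid edges and the colouring without red squares\<close>

lemma row_edge_in_grid_edges:
  "i \<in> {1..N} \<Longrightarrow> j \<in> {1..N} \<Longrightarrow> j' \<in> {1..N} \<Longrightarrow> j \<noteq> j' \<Longrightarrow> {(i, j), (i, j')} \<in> grid_edges N N"
  unfolding grid_edges_def grid_vertices_def by fastforce

lemma column_edge_in_grid_edges:
  "i \<in> {1..N} \<Longrightarrow> i' \<in> {1..N} \<Longrightarrow> j \<in> {1..N} \<Longrightarrow> i \<noteq> i' \<Longrightarrow> {(i, j), (i', j)} \<in> grid_edges N N"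
  unfolding grid_edges_def grid_vertices_def by fastforce

text \<open>Two clique vertices with different first coordinates share the second; a third one off
  that line would need the first coordinate of both.\<close>

lemma grid_clique_in_line:
  assumes "clique S (grid_edges N N)"
  shows "(\<exists>i. \<forall>s\<in>S. fst s = i) \<or> (\<exists>j. \<forall>s\<in>S. snd s = j)"
proof (rule ccontr)
  have one: "(fst u = fst v) \<noteq> (snd u = snd v)" if "u \<in> S" "v \<in> S" "u \<noteq> v" for u v
  proof -
    have "{u, v} \<in> grid_edges N N" using assms that by (auto simp: clique_def)
    then show ?thesis by (auto simp: grid_edges_def doubleton_eq_iff)
  qed
  assume no: "\<not> ?thesis"
  then obtain u v where uv: "u \<in> S" "v \<in> S" "fst u \<noteq> fst v" by blast
  then have s: "snd u = snd v" using one by fastforce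
  obtain w where w: "w \<in> S" "snd w \<noteq> snd u" using no uv by blast
  then have "fst w = fst u" "fst w = fst v" using one uv s by metis+
  then show False using uv by simp
qed

text \<open>Each numerical assumption pays for one ingredient: \<open>dom\<close> for the relation
  \<open>M\<close>, \<open>code\<close> for the words, \<open>few\<close> for the random letters. A
  single colouring serves all \<open>N0 < N\<close>, and excluding all red rectangles with both
  sides at least two covers both orientations of a subgrid.\<close>

lemma colouring_without_red_square:
  fixes q Q k N n :: nat
  assumes "k \<le> q" "0 < Q" "2 \<le> n"
    and dom: "2 * real q ^ k * (1 - 1 / 2 ^ k) ^ q < 1"
    and code: "N * q ^ k \<le> Q ^ k"
    and few: "real N ^ (n + 1) * (1 - 1 / real Q) ^ (n choose 2) < 1"
  shows "\<exists>col. \<forall>N0<N. \<not> has_blue_clique N0 col n \<and>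
           (\<forall>X Y. X \<subseteq> {1..N0} \<and> Y \<subseteq> {1..N0} \<and> 2 \<le> card X \<and> 2 \<le> card Y \<longrightarrow>
              \<not> (\<forall>e \<in> grid_edges N0 N0. e \<subseteq> X \<times> Y \<longrightarrow> col e = Red))"
proof -
  obtain M :: "nat \<Rightarrow> nat \<Rightarrow> bool"
    where M: "\<And>K. K \<subseteq> {..<q} \<Longrightarrow> card K \<le> k \<Longrightarrow>
      (\<exists>x<q. \<forall>z\<in>K. M x z) \<and> (\<exists>z<q. \<forall>x\<in>K. \<not> M x z)"
    using exists_dominating_relation[OF \<open>k \<le> q\<close> dom] by blast
  obtain c :: "nat \<Rightarrow> nat \<Rightarrow> nat"
    where c: "\<And>i x. i < N \<Longrightarrow> x < q \<Longrightarrow> c i x < Q"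
      and agree: "\<And>i j. i < N \<Longrightarrow> j < N \<Longrightarrow> i \<noteq> j \<Longrightarrow> card {x. x < q \<and> c i x = c j x} < k"
    using exists_code[OF \<open>k \<le> q\<close> \<open>0 < Q\<close> code] by blast
  define E where "E = {W. W \<subseteq> {..<N} \<and> card W = 2}"
  define agr where "agr W = {x. x < q \<and> (\<forall>i\<in>W. \<forall>j\<in>W. c i x = c j x)}" for W
  have agr: "agr W \<subseteq> {..<q} \<and> card (agr W) \<le> k" if W: "W \<in> E" for W
  proof -
    obtain i j where "W = {i, j}" "i \<noteq> j" using W unfolding E_def card_2_iff by blast
    moreover have "i < N" "j < N" using W \<open>W = {i, j}\<close> by (auto simp: E_def)
    ultimately have "agr W = {x. x < q \<and> c i x = c j x}" by (auto simp: agr_def)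
    then show ?thesis using agree[of i j] \<open>i \<noteq> j\<close> \<open>i < N\<close> \<open>j < N\<close> by auto
  qed
  define u where "u W = (SOME x. x < q \<and> (\<forall>z\<in>agr W. M x z))" for W
  define v where "v W = (SOME z. z < q \<and> (\<forall>x\<in>agr W. \<not> M x z))" for W
  have u: "u W < q \<and> (\<forall>z\<in>agr W. M (u W) z)" if "W \<in> E" for W
    unfolding u_def by (rule someI_ex) (use M[of "agr W"] agr[OF that] in blast)
  have v: "v W < q \<and> (\<forall>x\<in>agr W. \<not> M x (v W))" if "W \<in> E" for W
    unfolding v_def by (rule someI_ex) (use M[of "agr W"] agr[OF that] in blast)
  let ?A = "{..<N} \<times> {T. T \<subseteq> {..<N} \<and> card T = n}"
  \<comment> \<open>The requirement \<open>(i, T)\<close> asks for a pair inside \<open>T\<close>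
    that is red in line \<open>i\<close>. It has \<open>n choose 2\<close> chances, and there are at
    most \<open>N * N ^ n\<close> requirements. The place \<open>w W\<close> is left open so that
    rows (\<open>u\<close>) and columns (\<open>v\<close>) are treated at once.\<close>
  have hit: "\<exists>f. \<forall>i T. i < N \<and> T \<subseteq> {..<N} \<and> card T = n \<longrightarrow>
      (\<exists>W\<in>E. W \<subseteq> T \<and> f W = c i (w W))" if w: "\<And>W. W \<in> E \<Longrightarrow> w W < q" for w
  proof -
    have "\<exists>f. \<forall>a\<in>?A. \<exists>W\<in>{W. W \<subseteq> snd a \<and> card W = 2}. f W = c (fst a) (w W)"
    proof (rule exists_hitting_function[where E = E and Q = Q and p = "n choose 2"])
      have "N choose n \<le> N ^ n"
        by (cases "n \<le> N") (simp_all add: binomial_le_pow binomial_eq_0)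
      moreover have "card {T. T \<subseteq> {..<N} \<and> card T = n} = N choose n"
        using n_subsets[of "{..<N}" n] by simp
      ultimately have "card ?A \<le> N * N ^ n" by (simp add: card_cartesian_product)
      then have "real (card ?A) \<le> real N ^ (n + 1)" by (simp flip: of_nat_power of_nat_mult)
      then have "real (card ?A) * (1 - 1 / real Q) ^ (n choose 2)
          \<le> real N ^ (n + 1) * (1 - 1 / real Q) ^ (n choose 2)"
        using \<open>0 < Q\<close> by (intro mult_right_mono) auto
      then show "real (card ?A) * (1 - 1 / real Q) ^ (n choose 2) < 1" using few by linarith
      show "{W. W \<subseteq> snd a \<and> card W = 2} \<subseteq> E \<and> n choose 2 \<le> card {W. W \<subseteq> snd a \<and> card W = 2}"
        if "a \<in> ?A" for a
      proof -
        have a: "snd a \<subseteq> {..<N}" "card (snd a) = n" using that by auto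
        then have "finite (snd a)" using finite_subset by blast
        then show ?thesis using a n_subsets[of "snd a" 2] unfolding E_def by auto
      qed
      show "c (fst a) (w W) < Q" if "a \<in> ?A" "W \<in> E" for a W using that c w by auto
    qed (use \<open>0 < Q\<close> in \<open>auto simp: E_def\<close>)
    then obtain f where f: "\<forall>a\<in>?A. \<exists>W\<in>{W. W \<subseteq> snd a \<and> card W = 2}. f W = c (fst a) (w W)" ..
    have "\<exists>W\<in>E. W \<subseteq> T \<and> f W = c i (w W)" if "i < N" "T \<subseteq> {..<N}" "card T = n" for i T
    proof -
      have "(i, T) \<in> ?A" using that by simp
      from bspec[OF f this] show ?thesis using that(2) by (auto simp: E_def)
    qed
    then show ?thesis by blast
  qed
  obtain f where f: "\<And>i T. i < N \<Longrightarrow> T \<subseteq> {..<N} \<Longrightarrow> card T = n \<Longrightarrow>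
      \<exists>W\<in>E. W \<subseteq> T \<and> f W = c i (u W)"
    using hit[of u] u by blast
  obtain g where g: "\<And>j T. j < N \<Longrightarrow> T \<subseteq> {..<N} \<Longrightarrow> card T = n \<Longrightarrow>
      \<exists>W\<in>E. W \<subseteq> T \<and> g W = c j (v W)"
    using hit[of v] v by blast
  \<comment> \<open>A row edge projects to a single row but to two columns, a column edge the other
    way round, so at most one of the two clauses can apply to an edge.\<close>
  define col where "col e = (if (\<exists>i. fst ` e = {i} \<and> f (snd ` e) = c i (u (snd ` e))) \<or>
      (\<exists>j. snd ` e = {j} \<and> g (fst ` e) = c j (v (fst ` e))) then Red else Blue)"
    for e :: "(nat \<times> nat) set"
  have row: "col {(i, j), (i, j')} = Red \<longleftrightarrow> f {j, j'} = c i (u {j, j'})" if "j \<noteq> j'" for i j j'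
    using that by (auto simp: col_def)
  have column: "col {(i, j), (i', j)} = Red \<longleftrightarrow> g {i, i'} = c j (v {i, i'})" if "i \<noteq> i'" for i i' j
    using that by (auto simp: col_def)
  have "\<not> has_blue_clique N0 col n" if "N0 < N" for N0
  proof
    assume "has_blue_clique N0 col n"
    then obtain S where S: "S \<subseteq> grid_vertices N0 N0" "card S = n"
      and blue: "clique S {e \<in> grid_edges N0 N0. col e = Blue}"
      unfolding has_blue_clique_def by blast
    have ne: "S \<noteq> {}" using S \<open>2 \<le> n\<close> by auto
    have "clique S (grid_edges N0 N0)" using blue by (auto simp: clique_def)
    then consider i where "\<And>s. s \<in> S \<Longrightarrow> fst s = i" | j where "\<And>s. s \<in> S \<Longrightarrow> snd s = j"
      using grid_clique_in_line[of S N0] by blast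
    then show False
    proof cases
      case 1
      have "inj_on snd S" using 1 by (auto simp: inj_on_def prod_eq_iff)
      then have "card (snd ` S) = n" using S by (simp add: card_image)
      moreover have "snd ` S \<subseteq> {..<N}" "i < N"
        using S 1 ne \<open>N0 < N\<close> by (fastforce simp: grid_vertices_def)+
      ultimately obtain W where W: "W \<in> E" "W \<subseteq> snd ` S" "f W = c i (u W)" using f by blast
      then obtain j j' where "W = {j, j'}" "j \<noteq> j'" by (auto simp: E_def card_2_iff)
      moreover have "(i, j) \<in> S" "(i, j') \<in> S"
        using W(2) 1 \<open>W = {j, j'}\<close> by force+
      ultimately have "col {(i, j), (i, j')} = Blue"
        using blue by (auto simp: clique_def)
      then show False using row[OF \<open>j \<noteq> j'\<close>, of i] W \<open>W = {j, j'}\<close> by simp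
    next
      case 2
      have "inj_on fst S" using 2 by (auto simp: inj_on_def prod_eq_iff)
      then have "card (fst ` S) = n" using S by (simp add: card_image)
      moreover have "fst ` S \<subseteq> {..<N}" "j < N"
        using S 2 ne \<open>N0 < N\<close> by (fastforce simp: grid_vertices_def)+
      ultimately obtain W where W: "W \<in> E" "W \<subseteq> fst ` S" "g W = c j (v W)" using g by blast
      then obtain i i' where "W = {i, i'}" "i \<noteq> i'" by (auto simp: E_def card_2_iff)
      moreover have "(i, j) \<in> S" "(i', j) \<in> S"
        using W(2) 2 \<open>W = {i, i'}\<close> by force+
      ultimately have "col {(i, j), (i', j)} = Blue"
        using blue by (auto simp: clique_def)
      then show False using column[OF \<open>i \<noteq> i'\<close>, of j] W \<open>W = {i, i'}\<close> by simp
    qed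
  qed
  moreover have "\<not> (\<forall>e \<in> grid_edges N0 N0. e \<subseteq> X \<times> Y \<longrightarrow> col e = Red)"
    if "N0 < N" "X \<subseteq> {1..N0}" "Y \<subseteq> {1..N0}" "2 \<le> card X" "2 \<le> card Y" for N0 X Y
  proof
    assume red: "\<forall>e \<in> grid_edges N0 N0. e \<subseteq> X \<times> Y \<longrightarrow> col e = Red"
    obtain i i' where ii: "i \<in> X" "i' \<in> X" "i \<noteq> i'"
      using \<open>2 \<le> card X\<close> by (metis card_2_iff' card_le_Suc0_iff_eq card.infinite not_less_eq_eq numeral_2_eq_2 zero_le)
    obtain j j' where jj: "j \<in> Y" "j' \<in> Y" "j \<noteq> j'"
      using \<open>2 \<le> card Y\<close> by (metis card_2_iff' card_le_Suc0_iff_eq card.infinite not_less_eq_eq numeral_2_eq_2 zero_le)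
    have I: "{i, i'} \<in> E" and J: "{j, j'} \<in> E"
      using ii jj that(1-3) by (auto simp: E_def card_2_iff subset_eq)
    have r: "col {(x, j), (x, j')} = Red" if "x \<in> X" for x
    proof -
      have "{(x, j), (x, j')} \<in> grid_edges N0 N0"
        using that jj \<open>X \<subseteq> _\<close> \<open>Y \<subseteq> _\<close> by (intro row_edge_in_grid_edges) auto
      then show ?thesis using red that jj by auto
    qed
    have s: "col {(i, y), (i', y)} = Red" if "y \<in> Y" for y
    proof -
      have "{(i, y), (i', y)} \<in> grid_edges N0 N0"
        using that ii \<open>X \<subseteq> _\<close> \<open>Y \<subseteq> _\<close> by (intro column_edge_in_grid_edges) auto
      then show ?thesis using red that ii by auto
    qed
    \<comment> \<open>The pair of columns is red in both rows, so both row words have the letter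
      \<open>f {j, j'}\<close> at the place \<open>u {j, j'}\<close>; the argument for
      \<open>v\<close> is dual.\<close>
    have "u {j, j'} \<in> agr {i, i'}"
      using r[OF ii(1)] r[OF ii(2)] u[OF J] by (auto simp: row[OF jj(3)] agr_def)
    moreover have "v {i, i'} \<in> agr {j, j'}"
      using s[OF jj(1)] s[OF jj(2)] v[OF I] by (auto simp: column[OF ii(3)] agr_def)
    ultimately show False using u[OF J] v[OF I] by blast
  qed
  ultimately show ?thesis by blast
qed

section \<open>Choice of parameters in the lower bound\<close>

lemma gr_geI:
  assumes "\<And>N0. N0 < N \<Longrightarrow> \<exists>col. \<not> has_red_subgrid N0 col a b \<and> \<not> has_blue_clique N0 col n"
  shows "enat N \<le> gr a b n"
  unfolding gr_def le_INF_iff using assms by (auto simp: not_less[symmetric])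

lemma not_has_red_subgrid:
  assumes "2 \<le> b" "b \<le> a"
    and "\<forall>X Y. X \<subseteq> {1..N} \<and> Y \<subseteq> {1..N} \<and> 2 \<le> card X \<and> 2 \<le> card Y \<longrightarrow>
           \<not> (\<forall>e \<in> grid_edges N N. e \<subseteq> X \<times> Y \<longrightarrow> col e = Red)"
  shows "\<not> has_red_subgrid N col a b"
proof
  assume "has_red_subgrid N col a b"
  then obtain X Y where XY: "X \<subseteq> {1..N}" "Y \<subseteq> {1..N}"
    "card X = a \<and> card Y = b \<or> card X = b \<and> card Y = a"
    "\<forall>e \<in> grid_edges N N. e \<subseteq> X \<times> Y \<longrightarrow> col e = Red"
    unfolding has_red_subgrid_def by blast
  then have "2 \<le> card X \<and> 2 \<le> card Y" using assms(1,2) by auto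
  then show False using assms(3) XY by blast
qed

text \<open>Serves the small \<open>n\<close>, where the claimed lower bound is at most 2. A side
  below 2 leaves no room for a red subgrid, and the all-red colouring has no blue edge.\<close>

lemma gr_ge_2:
  assumes "2 \<le> b" "b \<le> a" "2 \<le> n"
  shows "enat 2 \<le> gr a b n"
proof (rule gr_geI)
  fix N0 :: nat assume "N0 < 2"
  have "\<not> 2 \<le> card X" if "X \<subseteq> {1..N0}" for X
    using card_mono[OF _ that] \<open>N0 < 2\<close> by simp
  then have "\<not> has_red_subgrid N0 (\<lambda>_. Red) a b"
    using assms by (intro not_has_red_subgrid) auto
  moreover have "\<not> has_blue_clique N0 (\<lambda>_. Red) n"
  proof
    assume "has_blue_clique N0 (\<lambda>_. Red) n"
    then obtain S where "card S = n" "clique S {e \<in> grid_edges N0 N0. Red = Blue}"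
      unfolding has_blue_clique_def by blast
    then show False using \<open>2 \<le> n\<close> card_le_Suc0_iff_eq[of S]
      by (cases "finite S") (auto simp: clique_def)
  qed
  ultimately show "\<exists>col. \<not> has_red_subgrid N0 col a b \<and> \<not> has_blue_clique N0 col n" by blast
qed

lemma one_minus_inverse_power_le:
  assumes "1 \<le> (x :: real)"
  shows "(1 - 1 / x) ^ p \<le> exp (- (real p / x))"
proof -
  have "1 - 1 / x \<le> exp (- (1 / x))" using exp_ge_add_one_self[of "- (1 / x)"] by simp
  then have "(1 - 1 / x) ^ p \<le> exp (- (1 / x)) ^ p"
    using assms by (intro power_mono) (auto simp: field_simps)
  also have "\<dots> = exp (- (real p / x))" by (simp flip: exp_of_nat_mult)
  finally show ?thesis .
qed

lemma two_power_times_exp_less_1: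
  assumes "real m < y"
  shows "2 ^ m * exp (- y) < 1"
proof -
  have "(2::real) ^ m \<le> exp 1 ^ m"
    using exp_ge_add_one_self[of 1] by (intro power_mono) auto
  also have "\<dots> < exp y" using assms by (simp flip: exp_of_nat_mult)
  finally show ?thesis by (simp add: exp_minus field_simps)
qed

lemma gr_lower_power:
  assumes "2 \<le> b" "b \<le> a" "2 \<le> k" "1024 ^ k \<le> n"
  shows "enat (8 ^ (k * k)) \<le> gr a b n"
proof -
  \<comment> \<open>The shift by two makes \<open>k = 2\<close> the base case of the inductions
    below; the inequality \<open>k4\<close> fails for \<open>k = 1\<close>.\<close>
  obtain m where m: "k = m + 2" using \<open>2 \<le> k\<close> by (metis le_iff_add add.commute)
  have k4: "3 * (k * k) + 1 < 4 ^ k"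
    unfolding m by (induction m) (auto simp: algebra_simps)
  have k16: "12 * (k * k) \<le> 16 ^ k"
    unfolding m by (induction m) (auto simp: algebra_simps)
  \<comment> \<open>The base is \<open>1024 = 16 * 64\<close>: \<open>64 ^ k\<close> is the number
    of letters, and \<open>16 ^ k\<close> absorbs the polynomial factor.\<close>
  have "12 * (k * k) * 64 ^ k \<le> 16 ^ k * 64 ^ k" using k16 by simp
  also have "(16::nat) ^ k * 64 ^ k = 1024 ^ k" by (simp flip: power_mult_distrib)
  finally have n1: "12 * (k * k) * 64 ^ k \<le> n" using assms by linarith
  have "(1024::nat) ^ 1 \<le> 1024 ^ k" using \<open>2 \<le> k\<close> by (intro power_increasing) auto
  then have n0: "1024 \<le> n" using assms by simp
  \<comment> \<open>With \<open>q = 8 ^ k\<close> the factor \<open>2 * q ^ k\<close> is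
    \<open>2 ^ (3 * (k * k) + 1)\<close>, against a failure probability of at most
    \<open>exp (- (4 ^ k))\<close>.\<close>
  have dom: "2 * real (8 ^ k) ^ k * (1 - 1 / 2 ^ k) ^ (8 ^ k) < 1"
  proof -
    have "(1 - 1 / (2::real) ^ k) ^ (8 ^ k) \<le> exp (- (real (8 ^ k) / 2 ^ k))"
      by (intro one_minus_inverse_power_le) simp
    also have "real (8 ^ k) / 2 ^ k = 4 ^ k" by (simp flip: power_divide)
    finally have "2 * real (8 ^ k) ^ k * (1 - 1 / 2 ^ k) ^ (8 ^ k) \<le> 2 * real (8 ^ k) ^ k * exp (- (4 ^ k))"
      by (intro mult_left_mono) auto
    also have "2 * real (8 ^ k) ^ k * exp (- (4 ^ k)) = 2 ^ (3 * (k * k) + 1) * exp (- (4 ^ k))"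
    proof -
      have "2 * real (8 ^ k) ^ k = 2 * ((2 ^ 3) ^ k) ^ k" by simp
      also have "\<dots> = 2 ^ (3 * (k * k) + 1)"
        by (simp only: power_mult power_add power_one_right)
      finally show ?thesis by (rule arg_cong)
    qed
    also have "2 ^ (3 * (k * k) + 1) * exp (- (4 ^ k)) < (1::real)"
    proof (rule two_power_times_exp_less_1)
      have "real (3 * (k * k) + 1) < real (4 ^ k)" using k4 by (simp only: of_nat_less_iff)
      then show "real (3 * (k * k) + 1) < 4 ^ k" by simp
    qed
    finally show ?thesis .
  qed
  have code: "8 ^ (k * k) * (8 ^ k) ^ k \<le> (64 ^ k :: nat) ^ k"
    by (simp flip: power_mult power_mult_distrib)
  \<comment> \<open>Comparing exponents reduces this to
    \<open>3 * (k * k) * (n + 1) * 64 ^ k < n choose 2\<close>. By \<open>n1\<close> the left side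
    is at most \<open>n * (n + 1) / 4\<close>, about half of the right side.\<close>
  have few: "real (8 ^ (k * k)) ^ (n + 1) * (1 - 1 / real (64 ^ k)) ^ (n choose 2) < 1"
  proof -
    let ?X = "3 * (k * k) * (n + 1) * 64 ^ k"
    have "4 * ?X = (12 * (k * k) * 64 ^ k) * (n + 1)"
      by (simp add: algebra_simps)
    also have "\<dots> \<le> n * (n + 1)" using n1 by (intro mult_right_mono) auto
    finally have "4 * ?X + 4 \<le> n * (n + 1) + 4" by simp
    also have "\<dots> \<le> n * (n + 2)" using n0 by simp
    also have "\<dots> \<le> n * (2 * (n - 1))" using n0 by (intro mult_left_mono) auto
    also have "\<dots> = 2 * (n * (n - 1))" by simp
    finally have "?X + 1 \<le> n * (n - 1) div 2" by linarith
    then have "?X < n choose 2" unfolding choose_two by linarith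
    then have "real ((3 * (k * k) * (n + 1)) * 64 ^ k) < real (n choose 2)" by (simp only: of_nat_less_iff)
    then have A: "real (3 * (k * k) * (n + 1)) < real (n choose 2) / real (64 ^ k)"
      by (simp add: pos_less_divide_eq)
    have "real (8 ^ (k * k)) ^ (n + 1) * (1 - 1 / real (64 ^ k)) ^ (n choose 2)
        \<le> real (8 ^ (k * k)) ^ (n + 1) * exp (- (real (n choose 2) / real (64 ^ k)))"
      by (intro mult_left_mono one_minus_inverse_power_le) auto
    also have "real (8 ^ (k * k)) ^ (n + 1) * exp (- (real (n choose 2) / real (64 ^ k)))
        = 2 ^ (3 * (k * k) * (n + 1)) * exp (- (real (n choose 2) / real (64 ^ k)))"
    proof -
      have "real (8 ^ (k * k)) ^ (n + 1) = ((2 ^ 3) ^ (k * k)) ^ (n + 1)" by simp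
      also have "\<dots> = 2 ^ (3 * (k * k) * (n + 1))" by (simp only: power_mult)
      finally show ?thesis by (rule arg_cong)
    qed
    also have "2 ^ (3 * (k * k) * (n + 1)) * exp (- (real (n choose 2) / real (64 ^ k))) < 1"
      by (rule two_power_times_exp_less_1[OF A])
    finally show ?thesis .
  qed
  have "k \<le> 8 ^ k" by (rule order.trans[OF less_imp_le[OF less_exp]]) (simp add: power_mono)
  from colouring_without_red_square[OF this _ _ dom code few] n0
  obtain col where col: "\<forall>N0<8 ^ (k * k). \<not> has_blue_clique N0 col n \<and>
       (\<forall>X Y. X \<subseteq> {1..N0} \<and> Y \<subseteq> {1..N0} \<and> 2 \<le> card X \<and> 2 \<le> card Y \<longrightarrow>
          \<not> (\<forall>e \<in> grid_edges N0 N0. e \<subseteq> X \<times> Y \<longrightarrow> col e = Red))"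
    by auto
  show ?thesis
  proof (rule gr_geI)
    fix N0 :: nat assume "N0 < 8 ^ (k * k)"
    from col[rule_format, OF this] not_has_red_subgrid[OF assms(1,2)]
    show "\<exists>col. \<not> has_red_subgrid N0 col a b \<and> \<not> has_blue_clique N0 col n" by blast
  qed
qed

lemma gr_lower_bound:
  assumes "2 \<le> b" "b \<le> a" "2 \<le> n"
  shows "ereal (2 powr (1 / 400 * (log 2 (real n))\<^sup>2)) \<le> ereal_of_enat (gr a b n)"
proof -
  have *: ?thesis if "2 powr (1 / 400 * (log 2 (real n))\<^sup>2) \<le> real N" "enat N \<le> gr a b n" for N
  proof -
    have "ereal (2 powr (1 / 400 * (log 2 (real n))\<^sup>2)) \<le> ereal_of_enat (enat N)" using that by simp
    also have "\<dots> \<le> ereal_of_enat (gr a b n)" using that by (simp only: ereal_of_enat_le_iff)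
    finally show ?thesis .
  qed
  have log0: "0 \<le> log 2 (real n)" using \<open>2 \<le> n\<close> by simp
  show ?thesis
  \<comment> \<open>The constant is \<open>1 / (20 * 20)\<close>: below the threshold 20 the
    exponent is at most 1, and \<open>gr_ge_2\<close> is enough.\<close>
  proof (cases "log 2 (real n) < 20")
    case True
    then have "(log 2 (real n))\<^sup>2 \<le> 20\<^sup>2" using log0 by (intro power_mono) auto
    then have "2 powr (1 / 400 * (log 2 (real n))\<^sup>2) \<le> 2 powr 1" by (intro powr_mono) auto
    then show ?thesis using gr_ge_2[OF assms] by (intro *[of 2]) auto
  next
    case False
    \<comment> \<open>The largest \<open>k\<close> with \<open>1024 ^ k \<le> n\<close>, as
      \<open>1024 = 2 ^ 10\<close>; above the threshold it is at least 2.\<close>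
    define k where "k = nat \<lfloor>log 2 (real n) / 10\<rfloor>"
    have "real k = of_int \<lfloor>log 2 (real n) / 10\<rfloor>" using log0 by (simp add: k_def)
    then have k1: "real k \<le> log 2 (real n) / 10" and k2: "log 2 (real n) / 10 < real k + 1"
      by linarith+
    then have "2 \<le> k" using False by (simp add: k_def le_nat_iff le_floor_iff)
    have "real (1024 ^ k) = 2 powr (10 * real k)"
      by (simp add: powr_realpow[symmetric] powr_powr[symmetric])
    also have "\<dots> \<le> 2 powr log 2 (real n)" using k1 by (intro powr_mono) auto
    also have "\<dots> = real n" using \<open>2 \<le> n\<close> by simp
    finally have "1024 ^ k \<le> n" by (simp only: of_nat_le_iff)
    then have g: "enat (8 ^ (k * k)) \<le> gr a b n" using gr_lower_power[OF assms(1,2) \<open>2 \<le> k\<close>] by simp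
    \<comment> \<open>From \<open>log 2 n < 10 * (k + 1) \<le> 20 * k\<close> the exponent is at
      most \<open>k * k\<close>, well within the \<open>3 * (k * k)\<close> of
      \<open>8 ^ (k * k)\<close>.\<close>
    have "log 2 (real n) \<le> 20 * real k" using k2 False \<open>2 \<le> k\<close> by linarith
    then have "(log 2 (real n))\<^sup>2 \<le> (20 * real k)\<^sup>2" using log0 by (intro power_mono) auto
    then have "1 / 400 * (log 2 (real n))\<^sup>2 \<le> 3 * (real k * real k)"
      by (simp add: power2_eq_square) (smt (verit) zero_le_square)
    then have "2 powr (1 / 400 * (log 2 (real n))\<^sup>2) \<le> 2 powr (3 * (real k * real k))"
      by (intro powr_mono) auto
    also have "\<dots> = real (8 ^ (k * k))"
      by (simp add: powr_powr[symmetric] flip: powr_realpow of_nat_mult)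
    finally show ?thesis using * g by blast
  qed
qed

subsection \<open>Cliques and independent sets\<close>

lemma exists_large_fibre:
  assumes "finite U" "finite T" "T \<noteq> {}" "f ` U \<subseteq> T"
  shows "\<exists>t\<in>T. card U \<le> card T * card {u\<in>U. f u = t}"
proof (rule ccontr)
  assume "\<not> ?thesis"
  then have less: "\<And>t. t \<in> T \<Longrightarrow> card T * card {u\<in>U. f u = t} < card U" by (auto simp: not_le)
  have "card U = (\<Sum>t\<in>T. card {u\<in>U. f u = t})"
    using sum.group[OF assms(1,2,4), of "\<lambda>_. 1 :: nat"] by simp
  then have "card T * card U = (\<Sum>t\<in>T. card T * card {u\<in>U. f u = t})"
    by (simp add: sum_distrib_left)
  also have "\<dots> < (\<Sum>t\<in>T. card U)"
    using assms(2,3) less by (intro sum_strict_mono) auto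
  finally show False by simp
qed

lemma card_UN_le_mult:
  assumes "finite I" "\<And>i. i \<in> I \<Longrightarrow> card (A i) \<le> K"
  shows "card (\<Union>i\<in>I. A i) \<le> card I * K"
  using order_trans[OF card_UN_le[OF assms(1)] sum_bounded_above[OF assms(2)]] by simp

text \<open>Each of \<open>d\<close> rounds adds one element of \<open>S\<close> or nothing, hence
  the base \<open>card S + 1\<close>. This will count the possible neighbourhoods inside an
  independent set.\<close>

lemma card_small_subsets_le:
  assumes "finite S"
  shows "card {D. D \<subseteq> S \<and> card D \<le> d} \<le> (card S + 1) ^ d"
proof (induction d)
  case 0
  have "{D. D \<subseteq> S \<and> card D \<le> 0} = {{}}" using assms finite_subset by fastforce
  then show ?case by simp
next
  case (Suc d)
  let ?P = "\<lambda>d. {D. D \<subseteq> S \<and> card D \<le> d}"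
  let ?g = "\<lambda>(D, T). D \<union> T"
  let ?T = "insert {} ((\<lambda>s. {s}) ` S)"
  have "?P (Suc d) \<subseteq> ?g ` (?P d \<times> ?T)"
  proof
    fix D assume D: "D \<in> ?P (Suc d)"
    show "D \<in> ?g ` (?P d \<times> ?T)"
    proof (cases "D = {}")
      case True
      then show ?thesis by (intro image_eqI[of _ _ "({}, {})"]) auto
    next
      case False
      then obtain s where "s \<in> D" by blast
      moreover have "finite D" using D assms finite_subset by blast
      ultimately show ?thesis using D
        by (intro image_eqI[of _ _ "(D - {s}, {s})"]) auto
    qed
  qed
  moreover have "finite (?P d \<times> ?T)" using assms by simp
  ultimately have "card (?P (Suc d)) \<le> card (?P d \<times> ?T)" by (rule surj_card_le[rotated])
  also have "\<dots> = card (?P d) * card ?T" by (rule card_cartesian_product)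
  also have "card ?T = card S + 1" using assms by (subst card_insert_disjoint) (auto simp: card_image)
  also have "card (?P d) * (card S + 1) \<le> (card S + 1) ^ d * (card S + 1)"
    using Suc by (rule mult_right_mono) simp
  also have "\<dots> = (card S + 1) ^ Suc d" by (rule power_Suc2[symmetric])
  finally show ?case .
qed

text \<open>A maximum independent set has fewer than \<open>n\<close> vertices and dominates
  \<open>V\<close>, so one of its vertices has at least \<open>n ^ l\<close> neighbours, and the
  induction continues among these.\<close>

lemma clique_or_independent:
  assumes "finite V" "n ^ l \<le> card V" "0 < n" and sym: "\<And>u v. E u v = E v u"
  shows "(\<exists>S\<subseteq>V. card S = l \<and> pairwise E S) \<or>
         (\<exists>S\<subseteq>V. card S = n \<and> pairwise (\<lambda>u v. \<not> E u v) S)"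
  using assms(1,2)
proof (induction l arbitrary: V)
  case 0
  then show ?case by (intro disjI1 exI[of _ "{}"]) auto
next
  case (Suc l)
  show ?case
  proof (rule disjCI)
    assume no: "\<not> (\<exists>S\<subseteq>V. card S = n \<and> pairwise (\<lambda>u v. \<not> E u v) S)"
    let ?I = "\<lambda>S. S \<subseteq> V \<and> pairwise (\<lambda>u v. \<not> E u v) S"
    have small: "card S < n" if "?I S" for S
    proof (rule ccontr)
      assume "\<not> card S < n"
      then obtain S' where "S' \<subseteq> S" "card S' = n" by (meson not_less obtain_subset_with_card_n)
      moreover have "pairwise (\<lambda>u v. \<not> E u v) S'"
        using that \<open>S' \<subseteq> S\<close> by (blast intro: pairwise_subset)
      ultimately show False using no that by blast
    qed
    have "?I {}" by simp
    then obtain S where S: "?I S" and max: "\<And>S'. ?I S' \<Longrightarrow> card S' \<le> card S"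
      using ex_has_greatest_nat[of ?I "{}" card n] small by (metis less_imp_le_nat)
    have finS: "finite S" using S Suc.prems finite_subset by blast
    let ?N = "\<lambda>s. {v\<in>V. v \<noteq> s \<and> E s v}"
    have cover: "V \<subseteq> (\<Union>s\<in>S. insert s (?N s))"
    proof
      fix v assume v: "v \<in> V"
      show "v \<in> (\<Union>s\<in>S. insert s (?N s))"
      proof (rule ccontr)
        assume *: "v \<notin> (\<Union>s\<in>S. insert s (?N s))"
        then have "?I (insert v S)" using S v sym by (auto simp: pairwise_insert)
        moreover have "v \<notin> S" using * by auto
        ultimately show False using max[of "insert v S"] finS by simp
      qed
    qed
    have "\<exists>s\<in>S. n ^ l \<le> card (?N s)"
    proof (rule ccontr)
      assume "\<not> ?thesis"
      \<comment> \<open>The strict bound on the number of neighbours leaves room for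
        \<open>s\<close> itself.\<close>
      then have "\<And>s. s \<in> S \<Longrightarrow> card (insert s (?N s)) \<le> n ^ l"
        using Suc.prems(1) by (auto simp: not_le Suc_le_eq)
      then have "card (\<Union>s\<in>S. insert s (?N s)) \<le> card S * n ^ l"
        by (rule card_UN_le_mult[OF finS])
      moreover have "card V \<le> card (\<Union>s\<in>S. insert s (?N s))"
        using finS Suc.prems(1) by (intro card_mono cover) auto
      moreover have "card S * n ^ l < n * n ^ l"
        using small[OF S] \<open>0 < n\<close> by (intro mult_strict_right_mono) auto
      moreover have "n * n ^ l \<le> card V" using Suc.prems(2) by simp
      ultimately show False by linarith
    qed
    then obtain s where s: "s \<in> S" "n ^ l \<le> card (?N s)" by blast
    have "\<exists>T\<subseteq>?N s. card T = l \<and> pairwise E T"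
    proof -
      have "finite (?N s)" using Suc.prems by simp
      from Suc.IH[OF this s(2)] show ?thesis
      proof (elim disjE)
        assume "\<exists>S\<subseteq>?N s. card S = n \<and> pairwise (\<lambda>u v. \<not> E u v) S"
        then have False using no by blast
        then show ?thesis ..
      qed
    qed
    then obtain T where T: "T \<subseteq> ?N s" "card T = l" "pairwise E T" by blast
    then have "s \<notin> T" "finite T" using Suc.prems(1) by (auto intro: finite_subset)
    then have "card (insert s T) = Suc l" using T by simp
    moreover have "pairwise E (insert s T)" using T sym by (auto simp: pairwise_insert)
    moreover have "insert s T \<subseteq> V" using T S s by auto
    ultimately show "\<exists>S\<subseteq>V. card S = Suc l \<and> pairwise E S" by blast
  qed
qed

text \<open>Induction on the sum of the targets: pass to the neighbours of a vertex in its most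
  frequent colour and lower the target of that colour. Targets vary with the colour because cliques
  of size \<open>b\<close> will compete with independent sets of size \<open>d + 1\<close>.\<close>

lemma multicolour_ramsey:
  assumes "finite C" "2 \<le> card C" "finite V" "card C ^ (\<Sum>c\<in>C. k c) \<le> card V"
    and sym: "\<And>u v. f u v = f v u" and col: "\<And>u v. f u v \<in> C"
  shows "\<exists>c\<in>C. \<exists>S\<subseteq>V. card S = k c \<and> pairwise (\<lambda>u v. f u v = c) S"
  using assms(3,4)
proof (induction "\<Sum>c\<in>C. k c" arbitrary: k V)
  case 0
  obtain c where "c \<in> C" using assms(2) by fastforce
  then have "k c = 0" using 0 \<open>finite C\<close> by simp
  then show ?case using \<open>c \<in> C\<close> by (intro bexI[of _ c] exI[of _ "{}"]) auto
next
  case (Suc s)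
  show ?case
  proof (cases "\<exists>c\<in>C. k c = 0")
    case True
    then obtain c where "c \<in> C" "k c = 0" by blast
    then show ?thesis by (intro bexI[of _ c] exI[of _ "{}"]) auto
  next
    case False
    have big: "card C * card C ^ s \<le> card V" using Suc.prems Suc.hyps(2)[symmetric] by simp
    have pos: "0 < card C ^ s" using assms(2) by simp
    then have "V \<noteq> {}" using big assms(2) by (cases "V = {}") auto
    then obtain v where v: "v \<in> V" by blast
    let ?N = "\<lambda>c. {u\<in>V. u \<noteq> v \<and> f v u = c}"
    have "\<exists>c\<in>C. card C ^ s \<le> card (?N c)"
    proof (rule ccontr)
      assume "\<not> ?thesis"
      then have "\<And>c. c \<in> C \<Longrightarrow> card (?N c) \<le> card C ^ s - 1" by (auto simp: not_le)
      then have "card (\<Union>c\<in>C. ?N c) \<le> card C * (card C ^ s - 1)"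
        by (rule card_UN_le_mult[OF \<open>finite C\<close>])
      moreover have "(\<Union>c\<in>C. ?N c) = V - {v}" using col by auto
      ultimately have "card V - 1 \<le> card C * (card C ^ s - 1)" using v by simp
      \<comment> \<open>Removing \<open>v\<close> loses one vertex, but if all classes are too
        small, at least \<open>card C \<ge> 2\<close> vertices are missing.\<close>
      moreover have "card C * (card C ^ s - 1) + card C = card C * card C ^ s"
        using pos by (simp add: right_diff_distrib')
      ultimately show False using big assms(2) by linarith
    qed
    then obtain c where c: "c \<in> C" "card C ^ s \<le> card (?N c)" by blast
    let ?k = "k(c := k c - 1)"
    have kc: "0 < k c" using False c by auto
    have "(\<Sum>x\<in>C. ?k x) + 1 = (\<Sum>x\<in>C. k x)"
      using kc c \<open>finite C\<close> by (simp add: sum.remove[of C c])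
    then have s: "s = (\<Sum>x\<in>C. ?k x)" using Suc.hyps(2) by simp
    have "finite (?N c)" using Suc.prems by simp
    from Suc.hyps(1)[OF s this] c(2) s
    obtain c' S where S: "c' \<in> C" "S \<subseteq> ?N c" "card S = ?k c'" "pairwise (\<lambda>u v. f u v = c') S"
      by auto
    show ?thesis
    proof (cases "c' = c")
      case True
      have "v \<notin> S" "finite S" using S Suc.prems(1) by (auto intro: finite_subset)
      then have "card (insert v S) = k c" using S(3) kc True by simp
      moreover have "pairwise (\<lambda>u v. f u v = c) (insert v S)"
        using S True sym by (auto simp: pairwise_insert)
      moreover have "insert v S \<subseteq> V" using S v by auto
      ultimately show ?thesis using c by blast
    next
      case False
      then show ?thesis using S by (intro bexI[of _ c'] exI[of _ S]) auto
    qed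
  qed
qed

text \<open>A vertex whose average degree over all graphs is large sees many vertices in the same set \<open>J1\<close>
  of graphs. Passing to these vertices and to \<open>J1\<close> builds the clique greedily; the pigeonhole
  over the \<open>2 ^ card J\<close> possible sets accounts for the factor \<open>2 ^ l\<close>.\<close>

lemma clique_in_many_graphs:
  fixes G :: "'j \<Rightarrow> 'v \<Rightarrow> 'v \<Rightarrow> bool" and y :: real
  assumes "finite W" "W \<noteq> {}" "finite J" "J \<noteq> {}" "card J \<le> l" "0 < y" "1 \<le> y * real m"
    and sym: "\<And>j u v. G j u v = G j v u" and irrefl: "\<And>j u. \<not> G j u u"
    and dense: "\<And>W' j. W' \<subseteq> W \<Longrightarrow> card W \<le> card W' * (m * 2 ^ l) ^ k \<Longrightarrow> j \<in> J \<Longrightarrow>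
      2 * y * (real (card W'))\<^sup>2 < real (\<Sum>v\<in>W'. card {u\<in>W'. G j v u})"
  shows "\<exists>X J'. X \<subseteq> W \<and> J' \<subseteq> J \<and> card X = k + 1 \<and> y ^ k * card J \<le> card J' \<and>
           (\<forall>j\<in>J'. pairwise (G j) X)"
  using assms(1-5) dense
proof (induction k arbitrary: W J)
  case 0
  then obtain w where "w \<in> W" by blast
  then show ?case by (intro exI[of _ "{w}"] exI[of _ J]) auto
next
  case (Suc k)
  let ?w = "real (card W)" and ?j = "real (card J)"
  have w0: "0 < ?w" and j0: "0 < ?j" using Suc.prems by (auto simp: card_gt_0_iff)
  have m0: "0 < m" using \<open>1 \<le> y * real m\<close> by (cases m) auto
  define D where "D v u = {j\<in>J. G j v u}" for v u
  have finD: "finite (D v u)" for v u using Suc.prems by (simp add: D_def)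
  have D_le: "card (D v u) \<le> card J" for v u unfolding D_def using Suc.prems by (intro card_mono) auto
  have count: "(\<Sum>j\<in>J. card {u\<in>W. G j v u}) = (\<Sum>u\<in>W. card (D v u))" for v
    unfolding D_def using sum_multicount_gen[of J W "\<lambda>j u. G j v u" "\<lambda>u. card {j\<in>J. G j v u}"] Suc.prems
    by simp
  \<comment> \<open>Averaging over \<open>v\<close>: the density assumption for
    \<open>W' = W\<close>, summed over \<open>J\<close>, counts the triples of two vertices and a
    graph joining them.\<close>
  have "\<exists>v\<in>W. 2 * y * ?w * ?j \<le> real (\<Sum>u\<in>W. card (D v u))"
  proof (rule ccontr)
    assume "\<not> ?thesis"
    then have lt: "\<And>v. v \<in> W \<Longrightarrow> real (\<Sum>u\<in>W. card (D v u)) \<le> 2 * y * ?w * ?j" by (meson linear)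
    have "(\<Sum>j\<in>J. 2 * y * ?w\<^sup>2) < (\<Sum>j\<in>J. real (\<Sum>v\<in>W. card {u\<in>W. G j v u}))"
      using Suc.prems m0 by (intro sum_strict_mono Suc.prems(6)) auto
    also have "\<dots> = (\<Sum>v\<in>W. real (\<Sum>j\<in>J. card {u\<in>W. G j v u}))"
      unfolding of_nat_sum by (rule sum.swap)
    also have "\<dots> \<le> (\<Sum>v\<in>W. 2 * y * ?w * ?j)"
      unfolding count by (intro sum_mono lt)
    finally show False by (simp add: power2_eq_square mult_ac)
  qed
  then obtain v where v: "v \<in> W" "2 * y * ?w * ?j \<le> real (\<Sum>u\<in>W. card (D v u))" by blast
  \<comment> \<open>A vertex outside \<open>U\<close> contributes at most \<open>y * card J\<close>,
    one inside at most \<open>card J\<close>; so at least half of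
    \<open>2 * y * card W * card J\<close> comes from \<open>U\<close>.\<close>
  define U where "U = {u\<in>W. y * ?j \<le> real (card (D v u))}"
  have finU: "finite U" using Suc.prems by (simp add: U_def)
  have "real (\<Sum>u\<in>W. card (D v u)) \<le> (\<Sum>u\<in>W. (if u \<in> U then ?j else 0) + y * ?j)"
    unfolding of_nat_sum
  proof (rule sum_mono)
    fix u assume "u \<in> W"
    then show "real (card (D v u)) \<le> (if u \<in> U then ?j else 0) + y * ?j"
      using D_le[of v u] \<open>0 < y\<close> by (auto simp: U_def intro: add_increasing2)
  qed
  also have "\<dots> = real (card U) * ?j + y * ?w * ?j"
  proof -
    have "W \<inter> {u. u \<in> U} = U" by (auto simp: U_def)
    then show ?thesis using Suc.prems(1) by (simp add: sum.distrib sum.If_cases mult_ac)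
  qed
  finally have "y * ?w * ?j \<le> real (card U) * ?j" using v(2) by linarith
  then have yU: "y * ?w \<le> real (card U)" using j0 by simp
  have "card (Pow J) \<le> 2 ^ l" using Suc.prems by (simp add: card_Pow power_increasing)
  moreover obtain J1 where J1: "J1 \<in> Pow J" "card U \<le> card (Pow J) * card {u\<in>U. D v u = J1}"
    using exists_large_fibre[of U "Pow J" "D v"] finU Suc.prems by (auto simp: D_def)
  ultimately have cU: "card U \<le> 2 ^ l * card {u\<in>U. D v u = J1}"
    by (meson mult_le_mono1 order_trans)
  define W1 where "W1 = {u\<in>U. D v u = J1}"
  have W1: "W1 \<subseteq> W" by (auto simp: W1_def U_def)
  \<comment> \<open>The number \<open>m\<close> is an integer bound for \<open>1 / y\<close>, so
    that the loss of one round becomes the natural number \<open>m * 2 ^ l\<close>.\<close>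
  have "?w \<le> (y * real m) * ?w" using \<open>1 \<le> y * real m\<close> w0 by simp
  also have "\<dots> = real m * (y * ?w)" by simp
  also have "\<dots> \<le> real m * real (card U)" using yU by (intro mult_left_mono) auto
  finally have "card W \<le> m * card U" by (simp flip: of_nat_mult)
  also have "\<dots> \<le> m * (2 ^ l * card W1)" using cU by (simp add: W1_def)
  finally have cW: "card W \<le> card W1 * (m * 2 ^ l)" by (simp add: mult_ac)
  then have ne1: "W1 \<noteq> {}" using w0 by auto
  then obtain u where "u \<in> W1" by blast
  then have yJ: "y * ?j \<le> real (card J1)" by (auto simp: W1_def U_def)
  then have J1ne: "J1 \<noteq> {}" using j0 \<open>0 < y\<close> by (auto simp: mult_le_0_iff)
  have cJ1: "card J1 \<le> l" using J1 Suc.prems(3,5) card_mono[of J J1] by auto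
  \<comment> \<open>No graph joins \<open>v\<close> to itself, so \<open>D v v\<close> is empty,
    unlike \<open>J1\<close>.\<close>
  have vW1: "v \<notin> W1" using J1ne irrefl by (auto simp: W1_def D_def)
  have "\<exists>X J'. X \<subseteq> W1 \<and> J' \<subseteq> J1 \<and> card X = k + 1 \<and> y ^ k * card J1 \<le> card J' \<and>
           (\<forall>j\<in>J'. pairwise (G j) X)"
  proof (rule Suc.IH)
    show "finite W1" using W1 Suc.prems(1) by (rule finite_subset)
    show "finite J1" using J1(1) Suc.prems(3) by (simp add: finite_subset)
    fix W' j assume W': "W' \<subseteq> W1" "card W1 \<le> card W' * (m * 2 ^ l) ^ k" "j \<in> J1"
    have "card W \<le> (card W' * (m * 2 ^ l) ^ k) * (m * 2 ^ l)"
      using cW W'(2) by (meson mult_le_mono1 order_trans)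
    then show "2 * y * (real (card W'))\<^sup>2 < real (\<Sum>v\<in>W'. card {u\<in>W'. G j v u})"
      using W' W1 J1 by (intro Suc.prems(6)) (auto simp: mult_ac)
  qed (use ne1 J1ne cJ1 in auto)
  then obtain X J' where X: "X \<subseteq> W1" "J' \<subseteq> J1" "card X = k + 1" "y ^ k * card J1 \<le> card J'"
    "\<forall>j\<in>J'. pairwise (G j) X" by blast
  have "finite X" using X(3) by (simp add: card_ge_0_finite)
  moreover have "v \<notin> X" using X(1) vW1 by blast
  ultimately have "card (insert v X) = Suc k + 1" using X(3) by simp
  moreover have "pairwise (G j) (insert v X)" if "j \<in> J'" for j
  proof -
    have "G j v x" if "x \<in> X" for x
      using that \<open>j \<in> J'\<close> X(1,2) by (auto simp: W1_def D_def)
    then show ?thesis using X(5) \<open>j \<in> J'\<close> sym by (auto simp: pairwise_insert)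
  qed
  moreover have "y ^ Suc k * card J \<le> card J'"
  proof -
    have "y ^ Suc k * card J = y ^ k * (y * ?j)" by simp
    also have "\<dots> \<le> y ^ k * card J1" using yJ \<open>0 < y\<close> by (intro mult_left_mono) auto
    finally show ?thesis using X(4) by linarith
  qed
  ultimately show ?case
    using X W1 J1 v(1) by (intro exI[of _ "insert v X"] exI[of _ J']) auto
qed

text \<open>Take a maximum independent set \<open>S\<close> among the vertices of low degree. Many vertices have the same
  set \<open>D\<close> of at most \<open>d\<close> neighbours in \<open>S\<close>. If these contained an independent set \<open>T\<close> of size
  \<open>d + 1\<close>, then \<open>(S - D) \<union> T\<close> would be larger than \<open>S\<close>.\<close>

lemma sparse_graph_independent_sets:
  fixes x :: real
  assumes "finite W" and sym: "\<And>u v. G u v = G v u" and "0 < x"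
    and sparse: "real (\<Sum>v\<in>W. card {u\<in>W. G v u}) \<le> x * (real (card W))\<^sup>2"
    and d: "16 * x * real n \<le> real d" and big: "4 * n \<le> card W"
    and ind: "\<And>S. S \<subseteq> W \<Longrightarrow> pairwise (\<lambda>u v. \<not> G u v) S \<Longrightarrow> card S < n"
  shows "\<exists>U\<subseteq>W. card W \<le> 8 * n ^ d * card U \<and>
           (\<forall>S\<subseteq>U. pairwise (\<lambda>u v. \<not> G u v) S \<longrightarrow> card S \<le> d)"
proof -
  let ?w = "real (card W)"
  have n0: "0 < n" using ind[of "{}"] by simp
  then have w0: "0 < ?w" using big by simp
  \<comment> \<open>The degree bound is twice the bound on the average degree, so by Markov's
    inequality at least half of \<open>W\<close> remains.\<close>
  define V where "V = {v\<in>W. real (card {u\<in>W. G v u}) \<le> 2 * x * ?w}"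
  have V: "V \<subseteq> W" by (auto simp: V_def)
  have finV: "finite V" using V assms(1) by (rule finite_subset)
  have halfW: "?w \<le> 2 * real (card V)"
  proof -
    have "real (card (W - V)) * (2 * x * ?w) = (\<Sum>v\<in>W - V. 2 * x * ?w)" by simp
    also have "\<dots> \<le> (\<Sum>v\<in>W - V. real (card {u\<in>W. G v u}))"
      by (intro sum_mono) (auto simp: V_def)
    also have "\<dots> \<le> (\<Sum>v\<in>W. real (card {u\<in>W. G v u}))"
      using assms(1) by (intro sum_mono2) auto
    also have "\<dots> \<le> ?w / 2 * (2 * x * ?w)" using sparse by (simp add: power2_eq_square mult_ac)
    finally have "real (card (W - V)) \<le> ?w / 2"
      using w0 \<open>0 < x\<close> by (subst (asm) mult_le_cancel_right) auto
    moreover have "real (card (W - V)) = ?w - real (card V)"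
      using V finV assms(1) by (simp add: card_Diff_subset card_mono of_nat_diff)
    ultimately show ?thesis by simp
  qed
  let ?I = "\<lambda>S. S \<subseteq> V \<and> pairwise (\<lambda>u v. \<not> G u v) S"
  have "?I {}" by simp
  then obtain S where S: "S \<subseteq> V" "pairwise (\<lambda>u v. \<not> G u v) S"
    and max: "\<And>S'. ?I S' \<Longrightarrow> card S' \<le> card S"
    using ex_has_greatest_nat[of ?I "{}" card n] ind V by (metis less_imp_le_nat order_trans)
  have finS: "finite S" using S(1) finV by (rule finite_subset)
  have Sn: "card S < n" using ind S V by blast
  define V' where "V' = V - S"
  have V': "V' \<subseteq> V" "V' \<inter> S = {}" "finite V'" using finV by (auto simp: V'_def)
  have quarter: "?w \<le> 4 * real (card V')"
  proof -
    have "real (card V') = real (card V) - real (card S)"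
      using S(1) finV finS by (simp add: V'_def card_Diff_subset card_mono of_nat_diff)
    moreover have "4 * real (card S) \<le> ?w" using Sn big by linarith
    ultimately show ?thesis using halfW by linarith
  qed
  define N where "N v = {s\<in>S. G v s}" for v
  define U3 where "U3 = {v\<in>V'. card (N v) \<le> d}"
  \<comment> \<open>Double counting between \<open>S\<close> and \<open>V'\<close>: the low degrees
    in \<open>S\<close> allow at most \<open>n * (2 * x * card W)\<close> edges, and each vertex
    outside \<open>U3\<close> takes more than \<open>d \<ge> 16 * x * n\<close> of them.\<close>
  have eighth: "?w \<le> 8 * real (card U3)"
  proof -
    have "real (card (V' - U3)) * (16 * x * real n) \<le> real (card (V' - U3)) * real d"
      using d by (intro mult_left_mono) auto
    also have "\<dots> = (\<Sum>v\<in>V' - U3. real d)" by simp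
    also have "\<dots> \<le> (\<Sum>v\<in>V' - U3. real (card (N v)))" by (intro sum_mono) (auto simp: U3_def)
    also have "\<dots> \<le> (\<Sum>v\<in>V'. real (card (N v)))" using V' by (intro sum_mono2) auto
    also have "\<dots> = real (\<Sum>s\<in>S. card {v\<in>V'. G v s})"
      unfolding N_def using sum_multicount_gen[of V' S "\<lambda>v s. G v s" "\<lambda>s. card {v\<in>V'. G v s}"] V' finS
      by (simp flip: of_nat_sum)
    also have "\<dots> \<le> (\<Sum>s\<in>S. 2 * x * ?w)"
      unfolding of_nat_sum
    proof (rule sum_mono)
      fix s assume "s \<in> S"
      then have "real (card {u\<in>W. G s u}) \<le> 2 * x * ?w" using S by (auto simp: V_def)
      moreover have "card {v\<in>V'. G v s} \<le> card {u\<in>W. G s u}"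
        using assms(1) V V' sym by (intro card_mono) auto
      ultimately show "real (card {v\<in>V'. G v s}) \<le> 2 * x * ?w" by linarith
    qed
    also have "\<dots> = real (card S) * (2 * x * ?w)" by simp
    also have "\<dots> \<le> real n * (2 * x * ?w)"
      using Sn \<open>0 < x\<close> by (intro mult_right_mono) auto
    also have "\<dots> = ?w / 8 * (16 * x * real n)" by simp
    finally have "real (card (V' - U3)) \<le> ?w / 8"
      using n0 \<open>0 < x\<close> by (subst (asm) mult_le_cancel_right) auto
    moreover have "real (card (V' - U3)) = real (card V') - real (card U3)"
      using V'(3) by (subst card_Diff_subset) (auto simp: U3_def card_mono of_nat_diff)
    ultimately show ?thesis using quarter by simp
  qed
  let ?P = "{D. D \<subseteq> S \<and> card D \<le> d}"
  have "card ?P \<le> (card S + 1) ^ d" by (rule card_small_subsets_le[OF finS])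
  also have "\<dots> \<le> n ^ d" using Sn by (intro power_mono) auto
  finally have cP: "card ?P \<le> n ^ d" .
  have "finite U3" using V' by (simp add: U3_def)
  then obtain D where D: "D \<in> ?P" "card U3 \<le> card ?P * card {v\<in>U3. N v = D}"
    using exists_large_fibre[of U3 ?P N] finS by (fastforce simp: U3_def N_def)
  define U where "U = {v\<in>U3. N v = D}"
  have UV: "U \<subseteq> V'" by (auto simp: U_def U3_def)
  have "card U3 \<le> n ^ d * card U" using D(2) cP unfolding U_def by (meson mult_le_mono1 order_trans)
  then have "card W \<le> 8 * n ^ d * card U" using eighth by linarith
  moreover have "card T \<le> d" if T: "T \<subseteq> U" "pairwise (\<lambda>u v. \<not> G u v) T" for T
  proof -
    have finT: "finite T" using T UV V' by (meson finite_subset)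
    have no_edge: "\<not> G t s" if "t \<in> T" "s \<in> S - D" for t s
      using that T(1) by (auto simp: U_def N_def)
    have "pairwise (\<lambda>u v. \<not> G u v) ((S - D) \<union> T)"
      using S(2) T(2) no_edge sym unfolding pairwise_def by blast
    moreover have "(S - D) \<union> T \<subseteq> V" using S T UV V' by blast
    ultimately have "card ((S - D) \<union> T) \<le> card S" by (intro max) auto
    moreover have "card ((S - D) \<union> T) = card (S - D) + card T"
      using T UV V' finS finT by (intro card_Un_disjoint) auto
    moreover have "card S \<le> card (S - D) + card D"
      using card_Un_le[of "S - D" D] D by (simp add: Un_absorb2)
    ultimately show ?thesis using D by simp
  qed
  ultimately show ?thesis using UV V' V by (intro exI[of _ U]) auto
qed

text \<open>If there is no \<open>b\<close>-clique common to \<open>a\<close> of the graphs, then on a large subset some graph is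
  sparse, hence on a further large subset it has no independent set larger than \<open>d\<close>. Repeating this
  for \<open>a\<close> different graphs leaves a situation that the multicolour Ramsey bound excludes.\<close>

lemma common_clique_or_independent:
  fixes G :: "'j \<Rightarrow> 'v \<Rightarrow> 'v \<Rightarrow> bool" and y :: real
  assumes "finite A" "finite J" "card J \<le> l" "2 \<le> b" "1 \<le> a" "0 < y" "1 \<le> y * real m" "0 < n"
    and sym: "\<And>j u v. G j u v = G j v u" and irrefl: "\<And>j u. \<not> G j u u"
    and cols: "real a \<le> y ^ (b - 1) * (real (card J) - real a)"
    and d: "32 * y * real n \<le> real d"
    and F: "F = (m * 2 ^ l) ^ (b - 1) * (8 * n ^ d)"
    and big: "4 * n * (a + 1) ^ (b + a * (d + 1)) * F ^ a \<le> card A"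
  shows "(\<exists>X J'. X \<subseteq> A \<and> J' \<subseteq> J \<and> card X = b \<and> card J' = a \<and> (\<forall>j\<in>J'. pairwise (G j) X)) \<or>
         (\<exists>j\<in>J. \<exists>S\<subseteq>A. card S = n \<and> pairwise (\<lambda>u v. \<not> G j u v) S)"
proof (rule disjCI, rule ccontr)
  assume no_ind: "\<not> (\<exists>j\<in>J. \<exists>S\<subseteq>A. card S = n \<and> pairwise (\<lambda>u v. \<not> G j u v) S)"
    and no_grid: "\<not> (\<exists>X J'. X \<subseteq> A \<and> J' \<subseteq> J \<and> card X = b \<and> card J' = a \<and> (\<forall>j\<in>J'. pairwise (G j) X))"
  have ind: "card S < n" if "j \<in> J" "S \<subseteq> A" "pairwise (\<lambda>u v. \<not> G j u v) S" for j S
  proof (rule ccontr)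
    assume "\<not> card S < n"
    then obtain S' where "S' \<subseteq> S" "card S' = n" by (meson not_less obtain_subset_with_card_n)
    moreover have "pairwise (\<lambda>u v. \<not> G j u v) S'"
      using that(3) \<open>S' \<subseteq> S\<close> by (blast intro: pairwise_subset)
    ultimately show False using no_ind that by blast
  qed
  have m0: "0 < m" using \<open>1 \<le> y * real m\<close> by (cases m) auto
  then have F0: "0 < F" using \<open>0 < n\<close> by (simp add: F)
  have bigF: "4 * n * F ^ a \<le> card A"
  proof -
    have "4 * n * F ^ a * 1 \<le> 4 * n * F ^ a * (a + 1) ^ (b + a * (d + 1))" by (intro mult_left_mono) auto
    also have "\<dots> = 4 * n * (a + 1) ^ (b + a * (d + 1)) * F ^ a" by (simp only: mult_ac)
    also note big
    finally show ?thesis by simp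
  qed
  \<comment> \<open>\<open>K\<close> collects the graphs that already have only small independent
    sets on \<open>U\<close>. One round costs the factor \<open>F\<close>: its first factor for
    reaching a set on which some further graph is sparse, its second for
    \<open>sparse_graph_independent_sets\<close>.\<close>
  have step: "\<exists>U K. U \<subseteq> A \<and> K \<subseteq> J \<and> card K = k \<and> card A \<le> card U * F ^ k \<and>
      (\<forall>j\<in>K. \<forall>S\<subseteq>U. pairwise (\<lambda>u v. \<not> G j u v) S \<longrightarrow> card S \<le> d)" if "k \<le> a" for k
    using that
  proof (induction k)
    case 0
    show ?case by (intro exI[of _ A] exI[of _ "{}"]) auto
  next
    case (Suc k)
    then obtain U K where U: "U \<subseteq> A" and K: "K \<subseteq> J" "card K = k" and cU: "card A \<le> card U * F ^ k"
      and small: "\<And>j S. j \<in> K \<Longrightarrow> S \<subseteq> U \<Longrightarrow> pairwise (\<lambda>u v. \<not> G j u v) S \<Longrightarrow> card S \<le> d"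
      by auto
    have finU: "finite U" using U assms(1) by (rule finite_subset)
    have finK: "finite K" using K(1) assms(2) by (rule finite_subset)
    have "4 * n * F * F ^ k = 4 * n * F ^ Suc k" by simp
    also have "\<dots> \<le> 4 * n * F ^ a" using Suc.prems F0 by (intro mult_left_mono power_increasing) auto
    finally have "4 * n * F * F ^ k \<le> card U * F ^ k" using bigF cU by linarith
    then have nU: "4 * n * F \<le> card U" using F0 by simp
    then have Une: "U \<noteq> {}" using F0 \<open>0 < n\<close> by auto
    have cJK: "real (card (J - K)) = real (card J) - real k"
      using K finK card_mono[OF assms(2) K(1)] by (simp add: card_Diff_subset of_nat_diff)
    have yb: "0 < y ^ (b - 1)" using \<open>0 < y\<close> by simp
    \<comment> \<open>Fewer than \<open>a\<close> graphs are used up so far, which is why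
      \<open>cols\<close> subtracts \<open>a\<close>: the remaining graphs still yield
      \<open>a\<close> that share a clique.\<close>
    have cols': "real a \<le> y ^ (b - 1) * real (card (J - K))"
      using cols yb Suc.prems unfolding cJK by (smt (verit) mult_left_mono of_nat_mono Suc_leD)
    have JKne: "J - K \<noteq> {}"
    proof
      assume e: "J - K = {}"
      show False using cols' \<open>1 \<le> a\<close> unfolding e by simp
    qed
    have "card (J - K) \<le> l" using assms(2,3) card_mono[of J "J - K"] by auto
    have "\<exists>W j. W \<subseteq> U \<and> card U \<le> card W * (m * 2 ^ l) ^ (b - 1) \<and> j \<in> J - K \<and>
        real (\<Sum>v\<in>W. card {u\<in>W. G j v u}) \<le> 2 * y * (real (card W))\<^sup>2"
    proof (rule ccontr)
      assume none: "\<not> ?thesis"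
      have dense: "2 * y * (real (card W'))\<^sup>2 < real (\<Sum>v\<in>W'. card {u\<in>W'. G j v u})"
        if "W' \<subseteq> U" "card U \<le> card W' * (m * 2 ^ l) ^ (b - 1)" "j \<in> J - K" for W' j
        using none that by (meson not_le)
      have "finite (J - K)" using assms(2) by simp
      note clique_in_many_graphs[where G = G and k = "b - 1" and m = m and l = l and y = y and W = U
          and J = "J - K"]
      from this[OF finU Une \<open>finite (J - K)\<close> JKne \<open>card (J - K) \<le> l\<close> \<open>0 < y\<close> \<open>1 \<le> y * real m\<close>
          sym irrefl dense]
      obtain X J' where X: "X \<subseteq> U" "J' \<subseteq> J - K" "card X = b - 1 + 1"
        "y ^ (b - 1) * card (J - K) \<le> card J'" "\<forall>j\<in>J'. pairwise (G j) X" by blast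
      have "a \<le> card J'" using X(4) cols' by linarith
      then obtain J'' where J'': "J'' \<subseteq> J'" "card J'' = a" by (meson obtain_subset_with_card_n)
      have "card X = b" using X(3) \<open>2 \<le> b\<close> by simp
      moreover have "X \<subseteq> A" "J'' \<subseteq> J" "\<forall>j\<in>J''. pairwise (G j) X" using X U J'' by blast+
      ultimately show False using no_grid J''(2) by blast
    qed
    then obtain W j where W: "W \<subseteq> U" "card U \<le> card W * (m * 2 ^ l) ^ (b - 1)" and j: "j \<in> J - K"
      and sparse: "real (\<Sum>v\<in>W. card {u\<in>W. G j v u}) \<le> 2 * y * (real (card W))\<^sup>2" by blast
    let ?M = "(m * 2 ^ l) ^ (b - 1)"
    have M0: "0 < ?M" using m0 by simp
    have "4 * n * ?M \<le> 4 * n * F" using \<open>0 < n\<close> by (intro mult_left_mono) (auto simp: F)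
    then have "4 * n * ?M \<le> card W * ?M" using nU W(2) by linarith
    then have nW: "4 * n \<le> card W" using M0 by (simp only: mult_le_cancel2)
    have "\<exists>U'\<subseteq>W. card W \<le> 8 * n ^ d * card U' \<and>
           (\<forall>S\<subseteq>U'. pairwise (\<lambda>u v. \<not> G j u v) S \<longrightarrow> card S \<le> d)"
    \<comment> \<open>Applied with \<open>x = 2 * y\<close>, whence \<open>32 = 16 * 2\<close> in
      the bound on \<open>d\<close>.\<close>
    proof (rule sparse_graph_independent_sets[OF _ _ _ sparse _ nW])
      show "finite W" using W(1) finU by (rule finite_subset)
      show "card S < n" if "S \<subseteq> W" "pairwise (\<lambda>u v. \<not> G j u v) S" for S
        using ind[of j S] that W U j by blast
    qed (use sym \<open>0 < y\<close> d in auto)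
    then obtain U' where U': "U' \<subseteq> W" "card W \<le> 8 * n ^ d * card U'"
      "\<And>S. S \<subseteq> U' \<Longrightarrow> pairwise (\<lambda>u v. \<not> G j u v) S \<Longrightarrow> card S \<le> d" by blast
    have "card U \<le> (8 * n ^ d * card U') * ?M" using W(2) U'(2) by (meson mult_le_mono1 order_trans)
    then have "card U \<le> card U' * F" by (simp add: F mult_ac)
    then have "card A \<le> (card U' * F) * F ^ k" using cU by (meson mult_le_mono1 order_trans)
    then have cA: "card A \<le> card U' * F ^ Suc k" by (simp add: mult_ac)
    have ck: "card (insert j K) = Suc k" using j finK K by simp
    have small': "card S \<le> d" if "i \<in> insert j K" "S \<subseteq> U'" "pairwise (\<lambda>u v. \<not> G i u v) S" for i S
    proof (cases "i = j")
      case True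
      then show ?thesis using U'(3) that by simp
    next
      case False
      then show ?thesis using small[of i S] that U'(1) W(1) by (metis insertE order_trans)
    qed
    have "U' \<subseteq> A" using U'(1) W(1) U by (meson order_trans)
    moreover have "insert j K \<subseteq> J" using j K by simp
    moreover have "\<forall>i\<in>insert j K. \<forall>S\<subseteq>U'. pairwise (\<lambda>u v. \<not> G i u v) S \<longrightarrow> card S \<le> d"
    proof (intro ballI allI impI)
      fix i S assume "i \<in> insert j K" "S \<subseteq> U'" "pairwise (\<lambda>u v. \<not> G i u v) S"
      then show "card S \<le> d" by (rule small')
    qed
    ultimately have "U' \<subseteq> A \<and> insert j K \<subseteq> J \<and> card (insert j K) = Suc k \<and> card A \<le> card U' * F ^ Suc k \<and>
        (\<forall>i\<in>insert j K. \<forall>S\<subseteq>U'. pairwise (\<lambda>u v. \<not> G i u v) S \<longrightarrow> card S \<le> d)"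
      using ck cA by (simp only: conj_absorb simp_thms)
    then show ?case by (intro exI)
  qed
  obtain U K where U: "U \<subseteq> A" and K: "K \<subseteq> J" "card K = a" and cU: "card A \<le> card U * F ^ a"
    and small: "\<And>j S. j \<in> K \<Longrightarrow> S \<subseteq> U \<Longrightarrow> pairwise (\<lambda>u v. \<not> G j u v) S \<Longrightarrow> card S \<le> d"
  proof -
    from step[OF order_refl] show thesis by (elim exE conjE) (rule that, assumption+, simp)
  qed
  have finU: "finite U" using U assms(1) by (rule finite_subset)
  have finK: "finite K" using K(1) assms(2) by (rule finite_subset)
  define C where "C = insert None (Some ` K)"
  have cC: "card C = a + 1" using K finK by (simp add: C_def card_image)
  \<comment> \<open>A pair gets the colour \<open>None\<close> if all graphs of \<open>K\<close>
    join it, and otherwise the name of one that does not. A class \<open>Some j\<close> of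
    \<open>d + 1\<close> vertices would be independent in graph \<open>j\<close>, against
    \<open>small\<close>; a class \<open>None\<close> of \<open>b\<close> vertices is the excluded
    common clique.\<close>
  define f where "f u v = (if \<forall>j\<in>K. G j u v then None else Some (SOME j. j \<in> K \<and> \<not> G j u v))" for u v
  define t where "t c = (if c = None then b else d + 1)" for c :: "'j option"
  have f_Some: "j \<in> K \<and> \<not> G j u v" if "f u v = Some j" for u v j
  proof -
    have "\<exists>j. j \<in> K \<and> \<not> G j u v" and j: "j = (SOME j. j \<in> K \<and> \<not> G j u v)"
      using that by (auto simp: f_def split: if_splits)
    then show ?thesis unfolding j by (intro someI_ex[of "\<lambda>j. j \<in> K \<and> \<not> G j u v"])
  qed
  have f_None: "\<forall>j\<in>K. G j u v" if "f u v = None" for u v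
    using that by (auto simp: f_def split: if_splits)
  have sumt: "(\<Sum>c\<in>C. t c) = b + a * (d + 1)"
    using K finK by (simp add: C_def t_def sum.reindex)
  have "(a + 1) ^ (b + a * (d + 1)) \<le> card U"
  proof -
    have "(a + 1) ^ (b + a * (d + 1)) * F ^ a \<le> 4 * n * ((a + 1) ^ (b + a * (d + 1)) * F ^ a)"
      using \<open>0 < n\<close> by simp
    also have "\<dots> = 4 * n * (a + 1) ^ (b + a * (d + 1)) * F ^ a" by (simp only: mult.assoc)
    also note big
    also note cU
    finally show ?thesis using F0 by (simp only: mult_le_cancel2) simp
  qed
  then have "card C ^ (\<Sum>c\<in>C. t c) \<le> card U" using cC sumt by simp
  moreover have "f u v \<in> C" for u v using f_Some[of u v] by (cases "f u v") (auto simp: C_def)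
  moreover have "f u v = f v u" for u v unfolding f_def by (simp only: sym)
  moreover have "finite C" "2 \<le> card C" using finK cC \<open>1 \<le> a\<close> by (auto simp: C_def)
  ultimately obtain c S where S: "c \<in> C" "S \<subseteq> U" "card S = t c" "pairwise (\<lambda>u v. f u v = c) S"
    using multicolour_ramsey[of C U t f] finU by blast
  show False
  proof (cases c)
    case None
    have "pairwise (G j) S" if "j \<in> K" for j
      using S(4) f_None that unfolding None pairwise_def by blast
    moreover have "S \<subseteq> A" "card S = b" using S U None by (auto simp: t_def)
    ultimately show False using no_grid K by blast
  next
    case (Some j)
    then have "j \<in> K" using S(1) by (auto simp: C_def)
    moreover have "pairwise (\<lambda>u v. \<not> G j u v) S"
      using S(4) f_Some unfolding Some pairwise_def by blast
    ultimately have "card S \<le> d" using small S by blast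
    then show False using S Some by (simp add: t_def)
  qed
qed

subsection \<open>The upper bound\<close>

lemma grid_edge_cases:
  assumes "e \<in> grid_edges N N"
  obtains (row) i j j' where "e = {(i, j), (i, j')}" "j \<noteq> j'"
    | (column) i i' j where "e = {(i, j), (i', j)}" "i \<noteq> i'"
proof -
  obtain i j i' j' where e: "e = {(i, j), (i', j')}" and ne: "(i = i') \<noteq> (j = j')"
    using assms by (auto simp: grid_edges_def)
  show thesis
  proof (cases "i = i'")
    case True
    then show thesis using e ne by (intro row[of i j j']) auto
  next
    case False
    then show thesis using e ne by (intro column[of i j i']) auto
  qed
qed

lemma has_blue_clique_row:
  assumes "S \<subseteq> {1..N}" "i \<in> {1..N}" "card S = n"
    and "pairwise (\<lambda>j j'. col {(i, j), (i, j')} \<noteq> Red) S"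
  shows "has_blue_clique N col n"
  unfolding has_blue_clique_def
proof (intro exI[of _ "Pair i ` S"] conjI)
  show "Pair i ` S \<subseteq> grid_vertices N N" using assms by (auto simp: grid_vertices_def)
  show "card (Pair i ` S) = n" using assms(3) by (simp add: card_image inj_on_def)
  show "clique (Pair i ` S) {e \<in> grid_edges N N. col e = Blue}"
    unfolding clique_def
  proof (intro ballI impI)
    fix u v assume "u \<in> Pair i ` S" "v \<in> Pair i ` S" "u \<noteq> v"
    then obtain j j' where *: "u = (i, j)" "v = (i, j')" "j \<in> S" "j' \<in> S" "j \<noteq> j'" by auto
    then have "col {u, v} \<noteq> Red" using assms(4) unfolding pairwise_def by blast
    then have "col {u, v} = Blue" by (cases "col {u, v}") simp_all
    moreover have "{u, v} \<in> grid_edges N N"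
      unfolding * using * assms by (intro row_edge_in_grid_edges) auto
    ultimately show "{u, v} \<in> {e \<in> grid_edges N N. col e = Blue}" by simp
  qed
qed

lemma has_blue_clique_column:
  assumes "S \<subseteq> {1..N}" "j \<in> {1..N}" "card S = n"
    and "pairwise (\<lambda>i i'. col {(i, j), (i', j)} \<noteq> Red) S"
  shows "has_blue_clique N col n"
  unfolding has_blue_clique_def
proof (intro exI[of _ "(\<lambda>i. (i, j)) ` S"] conjI)
  show "(\<lambda>i. (i, j)) ` S \<subseteq> grid_vertices N N" using assms by (auto simp: grid_vertices_def)
  show "card ((\<lambda>i. (i, j)) ` S) = n" using assms(3) by (simp add: card_image inj_on_def)
  show "clique ((\<lambda>i. (i, j)) ` S) {e \<in> grid_edges N N. col e = Blue}"
    unfolding clique_def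
  proof (intro ballI impI)
    fix u v assume "u \<in> (\<lambda>i. (i, j)) ` S" "v \<in> (\<lambda>i. (i, j)) ` S" "u \<noteq> v"
    then obtain i i' where *: "u = (i, j)" "v = (i', j)" "i \<in> S" "i' \<in> S" "i \<noteq> i'" by auto
    then have "col {u, v} \<noteq> Red" using assms(4) unfolding pairwise_def by blast
    then have "col {u, v} = Blue" by (cases "col {u, v}") simp_all
    moreover have "{u, v} \<in> grid_edges N N"
      unfolding * using * assms by (intro column_edge_in_grid_edges) auto
    ultimately show "{u, v} \<in> {e \<in> grid_edges N N. col e = Blue}" by simp
  qed
qed

text \<open>\<open>l\<close> columns are fixed which form a red clique in every row of a large set \<open>A\<close>; the column graphs
  on \<open>A\<close> then yield the red subgrid, with \<open>b\<close> rows and \<open>a\<close> columns.\<close>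

lemma gr_le:
  fixes y :: real
  assumes "2 \<le> b" "b \<le> a" "0 < n" "0 < y" "1 \<le> y * real m"
    and cols: "real a \<le> y ^ (b - 1) * (real l - real a)"
    and d: "32 * y * real n \<le> real d"
    and F: "F = (m * 2 ^ l) ^ (b - 1) * (8 * n ^ d)"
    and T: "T = n ^ (l * l) * (4 * n * (a + 1) ^ (b + a * (d + 1)) * F ^ a)"
  shows "gr a b n \<le> enat T"
proof -
  have "has_red_subgrid T col a b \<or> has_blue_clique T col n" for col
  proof (rule disjCI)
    assume no_blue: "\<not> has_blue_clique T col n"
    have "a < l"
    proof (rule ccontr)
      assume "\<not> a < l"
      then have "y ^ (b - 1) * (real l - real a) \<le> 0" using \<open>0 < y\<close> by (intro mult_nonneg_nonpos) auto
      then show False using cols assms(1,2) by linarith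
    qed
    have m0: "0 < m" using \<open>1 \<le> y * real m\<close> by (cases m) auto
    have F0: "0 < F" using m0 \<open>0 < n\<close> by (simp add: F)
    \<comment> \<open>The red cliques are sought among the first \<open>n ^ l\<close> columns only,
      which limits the candidates to \<open>n ^ (l * l)\<close>; these columns have to
      exist.\<close>
    have lT: "n ^ l \<le> T"
    proof -
      have "n ^ l * 1 \<le> n ^ (l * l) * (4 * n * (a + 1) ^ (b + a * (d + 1)) * F ^ a)"
        using \<open>0 < n\<close> \<open>a < l\<close> F0 by (intro mult_mono power_increasing) (auto simp: Suc_le_eq)
      then show ?thesis by (simp add: T)
    qed
    let ?R = "\<lambda>i j j'. col {(i, j), (i, j')} = Red"
    have "\<exists>S. S \<subseteq> {1..n ^ l} \<and> card S = l \<and> pairwise (?R i) S" if "i \<in> {1..T}" for i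
    proof -
      have "\<not> (\<exists>S\<subseteq>{1..n ^ l}. card S = n \<and> pairwise (\<lambda>j j'. \<not> ?R i j j') S)"
      proof
        assume "\<exists>S\<subseteq>{1..n ^ l}. card S = n \<and> pairwise (\<lambda>j j'. \<not> ?R i j j') S"
        then obtain S where S: "S \<subseteq> {1..n ^ l}" "card S = n" "pairwise (\<lambda>j j'. \<not> ?R i j j') S" by blast
        have "{1..n ^ l} \<subseteq> {1..T}" using lT by auto
        with S(1) have "S \<subseteq> {1..T}" by (rule order_trans)
        from has_blue_clique_row[OF this that S(2,3)] no_blue show False by contradiction
      qed
      moreover have "?R i j j' = ?R i j' j" for j j' by (simp add: insert_commute)
      ultimately show ?thesis
        using clique_or_independent[of "{1..n ^ l}" n l "?R i", OF _ _ \<open>0 < n\<close>] by fastforce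
    qed
    then have "\<forall>i\<in>{1..T}. \<exists>S. S \<subseteq> {1..n ^ l} \<and> card S = l \<and> pairwise (?R i) S" by (rule ballI)
    then obtain f where f_all: "\<forall>i\<in>{1..T}. f i \<subseteq> {1..n ^ l} \<and> card (f i) = l \<and> pairwise (?R i) (f i)"
      by (rule exE[OF bchoice])
    note f = bspec[OF f_all]
    let ?S = "{S. S \<subseteq> {1..n ^ l} \<and> card S = l}"
    have cS: "card ?S \<le> n ^ (l * l)"
    proof -
      have "(n ^ l) choose l \<le> (n ^ l) ^ l"
        by (cases "l \<le> n ^ l") (simp_all add: binomial_le_pow binomial_eq_0)
      then show ?thesis using n_subsets[of "{1..n ^ l}" l] by (simp flip: power_mult)
    qed
    have T0: "0 < T" using lT \<open>0 < n\<close> by (meson less_le_trans zero_less_power)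
    have fS: "f ` {1..T} \<subseteq> ?S" using f by blast
    have "1 \<in> {1..T}" using T0 by simp
    then have "f 1 \<in> ?S" using f by blast
    then have "?S \<noteq> {}" by (metis empty_iff)
    have "\<exists>J\<in>?S. card {1..T} \<le> card ?S * card {i\<in>{1..T}. f i = J}"
      by (rule exists_large_fibre) (use \<open>?S \<noteq> {}\<close> fS in simp_all)
    then obtain J where J: "J \<in> ?S" "card {1..T} \<le> card ?S * card {i\<in>{1..T}. f i = J}"
      by (rule bexE)
    define A where "A = {i\<in>{1..T}. f i = J}"
    have A: "A \<subseteq> {1..T}" and finA: "finite A" by (auto simp: A_def)
    have red_row: "?R i j j'" if "i \<in> A" "j \<in> J" "j' \<in> J" "j \<noteq> j'" for i j j'
      using f[of i] that by (auto simp: A_def pairwise_def)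
    have JT: "J \<subseteq> {1..T}" "finite J" "card J = l"
      using J lT by (auto intro: finite_subset)
    have "T \<le> n ^ (l * l) * card A"
      using J(2) cS by (simp add: A_def) (meson mult_le_mono1 order_trans)
    then have big: "4 * n * (a + 1) ^ (b + a * (d + 1)) * F ^ a \<le> card A"
      using \<open>0 < n\<close> by (simp only: T mult_le_cancel1) simp
    \<comment> \<open>The condition \<open>i \<noteq> i'\<close> makes the column graphs
      irreflexive: for equal rows the set is a singleton, whose colour is arbitrary.\<close>
    let ?G = "\<lambda>j i i'. i \<noteq> i' \<and> col {(i, j), (i', j)} = Red"
    have "(\<exists>X J'. X \<subseteq> A \<and> J' \<subseteq> J \<and> card X = b \<and> card J' = a \<and> (\<forall>j\<in>J'. pairwise (?G j) X)) \<or>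
         (\<exists>j\<in>J. \<exists>S\<subseteq>A. card S = n \<and> pairwise (\<lambda>u v. \<not> ?G j u v) S)"
      using finA JT(2,3) assms(1-5) cols d F big
      by (intro common_clique_or_independent[where l = l and y = y and m = m and d = d and F = F])
        (auto simp: insert_commute)
    then show "has_red_subgrid T col a b"
    proof (elim disjE)
      assume "\<exists>X J'. X \<subseteq> A \<and> J' \<subseteq> J \<and> card X = b \<and> card J' = a \<and> (\<forall>j\<in>J'. pairwise (?G j) X)"
      then obtain X J' where X: "X \<subseteq> A" "J' \<subseteq> J" "card X = b" "card J' = a"
        "\<forall>j\<in>J'. pairwise (?G j) X" by blast
      have "col e = Red" if "e \<in> grid_edges T T" "e \<subseteq> X \<times> J'" for e
        using that(1)
      proof (cases rule: grid_edge_cases)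
        case (row i j j')
        then show ?thesis using that(2) X red_row[of i j j'] by auto
      next
        case (column i i' j)
        then show ?thesis using that(2) X by (auto simp: pairwise_def)
      qed
      moreover have "X \<subseteq> {1..T}" "J' \<subseteq> {1..T}" using X A JT by blast+
      ultimately show ?thesis unfolding has_red_subgrid_def using X(3,4) by blast
    next
      assume "\<exists>j\<in>J. \<exists>S\<subseteq>A. card S = n \<and> pairwise (\<lambda>u v. \<not> ?G j u v) S"
      then obtain j S where S: "j \<in> J" "S \<subseteq> A" "card S = n" "pairwise (\<lambda>u v. \<not> ?G j u v) S" by blast
      have "pairwise (\<lambda>i i'. col {(i, j), (i', j)} \<noteq> Red) S" using S(4) by (simp add: pairwise_def)
      moreover have "S \<subseteq> {1..T}" "j \<in> {1..T}" using S A JT by blast+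
      ultimately have False using has_blue_clique_column[of S T j n col] no_blue S(3) by blast
      then show ?thesis ..
    qed
  qed
  then have "T \<in> {N. \<forall>col. has_red_subgrid N col a b \<or> has_blue_clique N col n}" by blast
  then show ?thesis unfolding gr_def by (rule INF_lower)
qed

section \<open>Choice of parameters in the upper bound\<close>

lemma gr_upper_bound:
  assumes "2 \<le> b" "b \<le> a" "2 \<le> n"
  shows "ereal_of_enat (gr a b n)
    \<le> ereal (2 powr ((8 * real a ^ 3 + 71 * real a ^ 2 + 69 * real a + 4) *
        real n powr (1 - 1 / (2 ^ b - 1)) * log 2 (real n)))"
proof -
  define e where "e = 1 - 1 / ((2::real) ^ b - 1)"
  define E where "E = real n powr e"
  define L where "L = log 2 (real n)"
  \<comment> \<open>The factor \<open>n ^ (l * l)\<close> contributes \<open>l * l * log 2 n\<close>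
    to the exponent, so \<open>l\<close> may have order \<open>n powr (e / 2)\<close>. The choice of
    \<open>y\<close> gives \<open>y ^ (b - 1) = 1 / m\<close>, and \<open>l = 2 * a * m\<close> then
    satisfies \<open>cols\<close>.\<close>
  define m where "m = nat \<lceil>real n powr (e / 2)\<rceil>"
  define l where "l = 2 * a * m"
  define y where "y = real m powr (- 1 / (real b - 1))"
  define d where "d = nat \<lceil>32 * y * real n\<rceil>"
  define q where "q = nat \<lceil>L\<rceil>"
  define F where "F = (m * 2 ^ l) ^ (b - 1) * (8 * n ^ d)"
  define T where "T = n ^ (l * l) * (4 * n * (a + 1) ^ (b + a * (d + 1)) * F ^ a)"
  have b1: "1 \<le> real b - 1" using assms(1) by simp
  have pow_b: "2 * real b - 1 \<le> 2 ^ b - 1"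
    using assms(1)
  proof (induction b rule: dec_induct)
    case (step c)
    then show ?case by simp
  qed simp
  have e_ge: "(2 * real b - 2) / (2 * real b - 1) \<le> e"
  proof -
    have "1 / (2 ^ b - 1) \<le> 1 / (2 * real b - 1)" using pow_b b1 by (intro divide_left_mono) auto
    moreover have "(2 * real b - 2) / (2 * real b - 1) = 1 - 1 / (2 * real b - 1)"
      using b1 by (simp add: field_simps)
    ultimately show ?thesis by (simp add: e_def)
  qed
  have e0: "0 < e"
  proof -
    have "0 < (2 * real b - 2) / (2 * real b - 1)" using b1 by (intro divide_pos_pos) auto
    then show ?thesis using e_ge by linarith
  qed
  have E1: "1 \<le> E" using assms(3) e0 unfolding E_def by (intro ge_one_powr_ge_zero) auto
  have L1: "1 \<le> L" unfolding L_def using assms(3) by (simp add: le_log_iff)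
  have s1: "1 \<le> real n powr (e / 2)" using assms(3) e0 by (intro ge_one_powr_ge_zero) auto
  have ms: "real n powr (e / 2) \<le> real m" unfolding m_def by linarith
  have m1: "1 \<le> real m" using ms s1 by linarith
  have "real m \<le> 2 * real n powr (e / 2)" using s1 unfolding m_def by linarith
  then have "(real m)\<^sup>2 \<le> (2 * real n powr (e / 2))\<^sup>2" by (intro power_mono) auto
  also have "\<dots> = 4 * E" unfolding E_def by (simp add: power2_eq_square flip: powr_add)
  finally have mE2: "(real m)\<^sup>2 \<le> 4 * E" .
  have "real m * 1 \<le> real m * real m" using m1 by (intro mult_left_mono) auto
  then have mE: "real m \<le> 4 * E" using mE2 by (simp add: power2_eq_square)
  have y0: "0 < y" unfolding y_def using m1 by simp
  have yb: "y ^ (b - 1) = 1 / real m"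
  proof -
    have "y ^ (b - 1) = y powr real (b - 1)" by (rule powr_realpow[OF y0, symmetric])
    also have "real (b - 1) = real b - 1" using assms(1) by (simp add: of_nat_diff)
    also have "y powr (real b - 1) = real m powr (- 1 / (real b - 1) * (real b - 1))"
      unfolding y_def by (rule powr_powr)
    also have "- 1 / (real b - 1) * (real b - 1) = - 1" using b1 by simp
    finally show ?thesis using m1 by (simp add: powr_minus_divide)
  qed
  have ym: "1 \<le> y * real m"
  proof -
    have "y * real m = real m powr (- 1 / (real b - 1)) * real m powr 1" using m1 by (simp add: y_def)
    also have "\<dots> = real m powr (- 1 / (real b - 1) + 1)" by (rule powr_add[symmetric])
    finally have "y * real m = real m powr (- 1 / (real b - 1) + 1)" .
    moreover have "0 \<le> - 1 / (real b - 1) + 1" using b1 by (simp add: field_simps)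
    ultimately show ?thesis using ge_one_powr_ge_zero[OF m1] by metis
  qed
  \<comment> \<open>\<open>y * n\<close> is at most \<open>n\<close> to the exponent
    \<open>1 - e / (2 * (b - 1))\<close>, which is at most \<open>e\<close> exactly if
    \<open>e\<close> is at least \<open>(2 * b - 2) / (2 * b - 1)\<close>. Here the cost of
    \<open>d\<close> is balanced against that of \<open>l * l\<close>.\<close>
  have yn: "y * real n \<le> E"
  proof -
    have "y \<le> (real n powr (e / 2)) powr (- 1 / (real b - 1))"
      unfolding y_def using ms s1 b1 assms(3) by (intro powr_mono2') auto
    also have "\<dots> = real n powr (- e / (2 * (real b - 1)))" by (simp add: powr_powr)
    finally have "y * real n \<le> real n powr (- e / (2 * (real b - 1))) * real n"
      by (intro mult_right_mono) auto
    also have "\<dots> = real n powr (- e / (2 * (real b - 1))) * real n powr 1" using assms(3) by simp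
    also have "\<dots> = real n powr (- e / (2 * (real b - 1)) + 1)" by (rule powr_add[symmetric])
    also have "\<dots> \<le> real n powr e"
    proof (intro powr_mono)
      have "2 * real b - 2 \<le> e * (2 * real b - 1)"
        using e_ge b1 by (simp add: pos_divide_le_eq)
      then show "- e / (2 * (real b - 1)) + 1 \<le> e"
        using b1 by (simp add: field_simps)
    qed (use assms(3) in simp)
    finally show ?thesis by (simp add: E_def)
  qed
  have cols: "real a \<le> y ^ (b - 1) * (real l - real a)"
  proof -
    have "real a * 1 \<le> real a * real m" using m1 by (intro mult_left_mono) auto
    then show ?thesis unfolding yb l_def using m1 by (simp add: field_simps)
  qed
  have d1: "32 * y * real n \<le> real d" unfolding d_def by linarith
  have gT: "gr a b n \<le> enat T"
    using assms y0 ym cols d1 by (intro gr_le[OF _ _ _ _ _ _ _ F_def T_def]) auto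
  have "0 \<le> 32 * y * real n" using y0 by simp
  then have dE: "real d \<le> 33 * E" using yn E1 unfolding d_def by linarith
  have qL: "real q \<le> 2 * L" using L1 unfolding q_def by linarith
  \<comment> \<open>Replacing \<open>n\<close> by a power of two reduces the estimate of
    \<open>T\<close> to adding exponents; rounding at most doubles \<open>L\<close>.\<close>
  have nq: "n \<le> 2 ^ q"
  proof -
    have "real n = 2 powr L" using assms(3) by (simp add: L_def)
    also have "\<dots> \<le> 2 powr real q" unfolding q_def by (intro powr_mono) linarith+
    also have "\<dots> = real (2 ^ q)" by (simp add: powr_realpow)
    finally show ?thesis by (simp only: of_nat_le_iff)
  qed
  define K where "K = q * (l * l) + (2 + q + a * (b + a * (d + 1)) + ((m + l) * (b - 1) + (3 + q * d)) * a)"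
  have "F \<le> (2 ^ m * 2 ^ l) ^ (b - 1) * (2 ^ 3 * (2 ^ q) ^ d)"
    unfolding F_def using nq less_exp[of m] by (intro mult_mono power_mono) auto
  also have "\<dots> = 2 ^ ((m + l) * (b - 1) + (3 + q * d))" by (simp only: power_add power_mult)
  finally have FK: "F \<le> 2 ^ ((m + l) * (b - 1) + (3 + q * d))" .
  have "a + 1 \<le> 2 ^ a" using less_exp[of a] by linarith
  then have "T \<le> (2 ^ q) ^ (l * l) * (2 ^ 2 * 2 ^ q * (2 ^ a) ^ (b + a * (d + 1)) *
      (2 ^ ((m + l) * (b - 1) + (3 + q * d))) ^ a)"
    unfolding T_def using nq FK by (intro mult_mono power_mono) auto
  also have "\<dots> = 2 ^ K" unfolding K_def by (simp only: power_add power_mult)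
  finally have TK: "T \<le> 2 ^ K" .
  have "real K \<le> (8 * real a ^ 3 + 71 * real a ^ 2 + 69 * real a + 4) * E * L"
  proof -
    \<comment> \<open>\<open>K\<close> splits into five summands, each at most a polynomial in
      \<open>a\<close> times \<open>E * L\<close>, where \<open>b\<close> enters only through
      \<open>b \<le> a\<close>. The quadratic coefficients 32, 35 and 4 add up to 71.\<close>
    let ?a = "real a" and ?h = "E * L"
    have Eh: "E \<le> ?h" and Lh: "L \<le> ?h" using E1 L1 by simp_all
    have h1: "1 \<le> ?h" using Eh E1 by linarith
    have "real (q * (l * l)) = real q * (4 * ?a\<^sup>2 * (real m)\<^sup>2)"
      by (simp add: l_def power2_eq_square)
    also have "\<dots> \<le> (2 * L) * (4 * ?a\<^sup>2 * (4 * E))"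
      using qL mE2 L1 by (intro mult_mono) auto
    finally have t1: "real (q * (l * l)) \<le> 32 * ?a\<^sup>2 * ?h" by (simp add: mult_ac)
    have t2: "real (2 + q) \<le> 4 * ?h" using qL Lh h1 by simp
    have "real (b + a * (d + 1)) = real b + ?a * (real d + 1)" by (simp add: algebra_simps)
    also have "\<dots> \<le> ?a * ?h + ?a * (34 * ?h)"
    proof (rule add_mono)
      have "real b \<le> ?a * 1" using assms(2) by simp
      also have "\<dots> \<le> ?a * ?h" using h1 by (intro mult_left_mono) auto
      finally show "real b \<le> ?a * ?h" .
      have "real d + 1 \<le> 34 * ?h" using dE Eh E1 by linarith
      then show "?a * (real d + 1) \<le> ?a * (34 * ?h)" by (rule mult_left_mono) simp
    qed
    also have "\<dots> = 35 * (?a * ?h)" by (simp add: mult_ac)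
    finally have "?a * real (b + a * (d + 1)) \<le> ?a * (35 * (?a * ?h))" by (rule mult_left_mono) simp
    also have "\<dots> = 35 * ?a\<^sup>2 * ?h" by (simp add: power2_eq_square)
    finally have t3: "real (a * (b + a * (d + 1))) \<le> 35 * ?a\<^sup>2 * ?h" by (simp only: of_nat_mult)
    have "real (m + l) = (1 + 2 * ?a) * real m" by (simp add: l_def algebra_simps)
    also have "\<dots> \<le> (1 + 2 * ?a) * (4 * ?h)" using mE Eh by (intro mult_left_mono) auto
    finally have "real (m + l) * real (b - 1) * ?a \<le> (1 + 2 * ?a) * (4 * ?h) * ?a * ?a"
      using assms(2) h1 by (intro mult_mono) auto
    also have "\<dots> = (8 * ?a ^ 3 + 4 * ?a\<^sup>2) * ?h"
      by (simp add: power2_eq_square power3_eq_cube algebra_simps)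
    finally have t4: "real ((m + l) * (b - 1) * a) \<le> (8 * ?a ^ 3 + 4 * ?a\<^sup>2) * ?h"
      by (simp only: of_nat_mult)
    have "real q * real d \<le> (2 * L) * (33 * E)" using qL dE L1 by (intro mult_mono) auto
    then have "3 + real q * real d \<le> 69 * ?h" using h1 by (simp add: mult_ac)
    then have "(3 + real q * real d) * ?a \<le> (69 * ?h) * ?a" by (intro mult_right_mono) auto
    then have t5: "real ((3 + q * d) * a) \<le> 69 * ?a * ?h" by (simp add: mult_ac)
    have "real K = real (q * (l * l)) + real (2 + q) + real (a * (b + a * (d + 1)))
        + real ((m + l) * (b - 1) * a) + real ((3 + q * d) * a)"
      by (simp only: K_def add_mult_distrib of_nat_add add.assoc)
    also have "\<dots> \<le> 32 * ?a\<^sup>2 * ?h + 4 * ?h + 35 * ?a\<^sup>2 * ?h + (8 * ?a ^ 3 + 4 * ?a\<^sup>2) * ?h + 69 * ?a * ?h"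
      by (intro add_mono t1 t2 t3 t4 t5)
    also have "\<dots> = (8 * ?a ^ 3 + 71 * ?a ^ 2 + 69 * ?a + 4) * E * L" by (simp add: algebra_simps)
    finally show ?thesis .
  qed
  then have "2 powr real K \<le> 2 powr ((8 * real a ^ 3 + 71 * real a ^ 2 + 69 * real a + 4) * E * L)"
    by (intro powr_mono) auto
  moreover have "real T \<le> 2 powr real K" using TK by (simp add: powr_realpow flip: of_nat_le_iff)
  ultimately have "real T \<le> 2 powr ((8 * real a ^ 3 + 71 * real a ^ 2 + 69 * real a + 4) * E * L)" by linarith
  moreover have "ereal_of_enat (gr a b n) \<le> ereal_of_enat (enat T)"
    using gT by (simp only: ereal_of_enat_le_iff)
  ultimately show ?thesis unfolding E_def e_def L_def using order_trans by fastforce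
qed

theorem theorem1p4:
  "\<exists>c::real. c > 0 \<and>
     (\<forall>a::nat. \<exists>c'::real. c' > 0 \<and>
        (\<forall>b::nat. 2 \<le> b \<and> b \<le> a \<longrightarrow>
           (\<forall>n::nat. 2 \<le> n \<longrightarrow>
              ereal (2 powr (c * (log 2 (real n))\<^sup>2)) \<le> ereal_of_enat (gr a b n) \<and>
              ereal_of_enat (gr a b n)
                \<le> ereal (2 powr (c' * real n powr (1 - 1 / (2 ^ b - 1)) * log 2 (real n))))))"
proof (rule exI[of _ "1 / 400"], intro conjI allI)
  fix a :: nat
  \<comment> \<open>The polynomial depends on \<open>a\<close> alone, so \<open>c'\<close> can be
    chosen before \<open>b\<close> and \<open>n\<close>.\<close>
  have pos: "0 < 8 * real a ^ 3 + 71 * real a ^ 2 + 69 * real a + 4"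
    by (intro add_nonneg_pos) auto
  show "\<exists>c'::real. c' > 0 \<and>
      (\<forall>b::nat. 2 \<le> b \<and> b \<le> a \<longrightarrow>
         (\<forall>n::nat. 2 \<le> n \<longrightarrow>
            ereal (2 powr (1 / 400 * (log 2 (real n))\<^sup>2)) \<le> ereal_of_enat (gr a b n) \<and>
            ereal_of_enat (gr a b n)
              \<le> ereal (2 powr (c' * real n powr (1 - 1 / (2 ^ b - 1)) * log 2 (real n)))))"
    using pos gr_lower_bound gr_upper_bound by blast
qed simp

end
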